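(* Suppose the risk-function assumption, the gradient-noise assumption and the network-topology assumption (all stated in the context) hold, and let the step-size sequence satisfy $$\mu(i)>0,\qquad \sum_{i=1}^\infty \mu(i)=\infty,\qquad \lim_{i\to\infty}\mu(i)=0 .$$ Then the iterates $w_{k,i}$ generated by the diffusion strategy converge in the mean-square-error sense to $w^o$, i.e. for every $k=1,\ldots,N$, $$\lim_{i\to\infty}\mathbb{E}\|w^o-w_{k,i}\|^2=0 .$$ If the step-size sequence satisfies in addition $\sum_{i=1}^\infty\mu^2(i)<\infty$, then $w_{k,i}$ converges to $w^o$ almost surely for all $k=1,\ldots,N$. Furthermore, when $\mu(i)=\mu/i$ with $\mu$ satisfying $2\underline{\lambda}\mu>1$, the second- and fourth-order moments of the error vector $\widetilde{w}_{k,i}=w^o-w_{k,i}$ converge at the rates $O(1/i)$ and $O(1/i^2)$, respectively: $$\limsup_{i\to\infty}\frac{\mathbb{E}\|\widetilde{w}_{k,i}\|^2}{i^{-1}}\le\frac{\sigma_{v2}^2\mu^2}{2\underline{\lambda}\mu-1},\qquad \limsup_{i\to\infty}\frac{\mathbb{E}\|\widetilde{w}_{k,i}\|^4}{i^{-2}}\le \text{constant}$$ (a finite constant).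
   Context: Vectors are columns; $\|\cdot\|$ is the Euclidean norm and the induced matrix norm; $\otimes$ is the Kronecker product; $\mathbf{1}_N$ is the $N\times1$ all-ones vector; matrix inequalities are in the positive semidefinite order. Setting: a network of $N$ agents; agent $k$ observes independent samples $x_{k,i}$, $i=1,2,\ldots$, from a fixed distribution $\mathcal{X}_k$. With loss $Q(w,x)$, $w\in\mathbb{R}^{M}$, the risk of agent $k$ is $J_k(w)=\mathbb{E}\,Q(w,x_{k,i})$. Diffusion strategy: starting from estimates $w_{k,0}$, for $i\ge1$ and $k=1,\ldots,N$, $$\psi_{k,i}=w_{k,i-1}-\mu(i)\nabla_wQ(w_{k,i-1},x_{k,i}),\qquad w_{k,i}=\sum_{\ell=1}^N a_{\ell k}\psi_{\ell,i},$$ where the combination matrix $A=[a_{\ell k}]$ has non-negative entries, is left-stochastic ($\sum_{\ell}a_{\ell k}=1$ for all $k$) and $a_{\ell k}=0$ if agents $\ell,k$ are not connected. Risk-function assumption: each $J_k$ is twice continuously differentiable and there are constants $0<\underline{\lambda}\le\overline{\lambda}<\infty$ with $\underline{\lambda}I_M\le\nabla_w^2J_k(w)\le\overline{\lambda}I_M$ for all $w$; all $J_k$ have the same minimizer $w^o=\arg\min_wJ_k(w)$; there are $\varepsilon>0$ and $\tau_k\ge0$ with $\|\nabla_w^2J_k(w^o)-\nabla_w^2J_k(w)\|\le\tau_k\|w^o-w\|$ whenever $\|w^o-w\|<\varepsilon$; and $H=\nabla_w^2J_k(w^o)>0$ is the same for all $k$. Gradient-noise assumption: let $v_{k,i}(w)=\nabla_wQ(w,x_{k,i})-\nabla_wJ_k(w)$;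 let $\mathcal{F}_{i-1}$ be the past history $\{w_{k,j}:k=1,\ldots,N,\ j\le i-1\}$; for $\mathcal{W}=\mathrm{col}\{w_1,\ldots,w_N\}$ let $g_i(\mathcal{W})=\mathrm{col}\{v_{1,i}(w_1),\ldots,v_{N,i}(w_N)\}$ and $\mathcal{R}_{g,i}(\mathcal{W})=\mathbb{E}\{g_i(\mathcal{W})g_i(\mathcal{W})^{T}\mid\mathcal{F}_{i-1}\}$. For every $w\in\mathcal{F}_{i-1}$: $\mathbb{E}\{v_{k,i}(w)\mid\mathcal{F}_{i-1}\}=0$ and $\mathbb{E}\{\|v_{k,i}(w)\|^4\mid\mathcal{F}_{i-1}\}\le\alpha_4\|w^o-w\|^4+\sigma_{v4}^4$ for some $\alpha_4,\sigma_{v4}^4\ge0$; $\mathbb{E}\{v_{k,i}(w^o)^{T}v_{\ell,i}(w^o)\}=0$ for $k\ne\ell$; for some $\kappa\ge0$, $0<\gamma\le4$ and small $\epsilon>0$, $\|\mathcal{R}_{g,i}(\mathcal{W})-\mathcal{R}_{g,i}(\mathbf{1}_N\otimes w^o)\|\le\kappa\|\mathbf{1}_N\otimes w^o-\mathcal{W}\|^\gamma$ whenever $\|\mathbf{1}_N\otimes w^o-\mathcal{W}\|\le\epsilon$; and the limit $\mathcal{R}_g^o=\lim_{i\to\infty}\mathbb{E}\{\mathcal{R}_{g,i}(\mathbf{1}_N\otimes w^o)\}$ exists. These conditions imply that there are constants $\alpha_2,\sigma_{v2}^2\ge0$ with $\mathbb{E}\{\|v_{k,i}(w)\|^2\mid\mathcal{F}_{i-1}\}\le\alpha_2\|w^o-w\|^2+\sigma_{v2}^2$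 for $w\in\mathcal{F}_{i-1}$; $\sigma_{v2}^2$ in the claim is this constant. Network-topology assumption: the network is strongly connected, so that $A$ is primitive; its Perron eigenvector $p$ satisfies $Ap=p$, $\mathbf{1}_N^{T}p=1$, and all entries of $p$ are positive. *)

theory Defs
  imports "HOL-Probability.Probability"
begin

section \<open>Matrices and derivatives\<close>

definition mat_norm :: "real^'m^'n \<Rightarrow> real" where
  "mat_norm B = onorm (\<lambda>x. B *v x)"

definition psd :: "real^'m^'m \<Rightarrow> bool" where
  "psd B \<longleftrightarrow> transpose B = B \<and> (\<forall>x. 0 \<le> x \<bullet> (B *v x))"

definition posdef :: "real^'m^'m \<Rightarrow> bool" where
  "posdef B \<longleftrightarrow> transpose B = B \<and> (\<forall>x. x \<noteq> 0 \<longrightarrow> 0 < x \<bullet> (B *v x))"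

definition loewner_le :: "real^'m^'m \<Rightarrow> real^'m^'m \<Rightarrow> bool" where
  "loewner_le B C \<longleftrightarrow> psd (C - B)"

definition gradient :: "(real^'m \<Rightarrow> real) \<Rightarrow> real^'m \<Rightarrow> real^'m" where
  "gradient f w = (THE D. GDERIV f w :> D)"

definition hessian :: "(real^'m \<Rightarrow> real) \<Rightarrow> real^'m \<Rightarrow> real^'m^'m" where
  "hessian f w = jacobian (gradient f) (at w)"

definition twice_cont_diff :: "(real^'m \<Rightarrow> real) \<Rightarrow> bool" where
  "twice_cont_diff f \<longleftrightarrow>
     (\<forall>w. f differentiable (at w)) \<and>
     (\<forall>w. gradient f differentiable (at w)) \<and>
     continuous_on UNIV (hessian f)"

section \<open>Diffusion strategy\<close>

text \<open>
  The agents are the elements of the finite type \<open>'n\<close>, the parameter space is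
  \<open>real^'m\<close>, and \<open>A $ l $ k\<close> is the weight with which agent \<open>k\<close> scales the
  intermediate estimate of agent \<open>l\<close>. Samples, step sizes and noises are indexed from 1;
  their values at index 0 are never constrained and play no role.
\<close>

definition adapt ::
  "(real^'m \<Rightarrow> 'x \<Rightarrow> real) \<Rightarrow> ('n \<Rightarrow> nat \<Rightarrow> 'w \<Rightarrow> 'x) \<Rightarrow> (nat \<Rightarrow> real) \<Rightarrow> nat
     \<Rightarrow> ('n \<Rightarrow> 'w \<Rightarrow> real^'m) \<Rightarrow> 'n \<Rightarrow> 'w \<Rightarrow> real^'m" where
  "adapt Q x mu i w k \<omega> =
     w k \<omega> - mu i *\<^sub>R gradient (\<lambda>u. Q u (x k i \<omega>)) (w k \<omega>)"

definition combine ::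
  "real^'n^'n \<Rightarrow> ('n \<Rightarrow> 'w \<Rightarrow> real^'m) \<Rightarrow> 'n \<Rightarrow> 'w \<Rightarrow> real^'m" where
  "combine A psi k \<omega> = (\<Sum>l\<in>UNIV. A $ l $ k *\<^sub>R psi l \<omega>)"

primrec diffusion ::
  "real^'n^'n \<Rightarrow> (real^'m \<Rightarrow> 'x \<Rightarrow> real) \<Rightarrow> ('n \<Rightarrow> nat \<Rightarrow> 'w \<Rightarrow> 'x) \<Rightarrow> (nat \<Rightarrow> real)
     \<Rightarrow> ('n \<Rightarrow> 'w \<Rightarrow> real^'m) \<Rightarrow> nat \<Rightarrow> 'n \<Rightarrow> 'w \<Rightarrow> real^'m" where
  "diffusion A Q x mu w0 0 = w0"
| "diffusion A Q x mu w0 (Suc i) =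
     combine A (adapt Q x mu (Suc i) (diffusion A Q x mu w0 i))"

definition history ::
  "'w measure \<Rightarrow> (nat \<Rightarrow> 'n \<Rightarrow> 'w \<Rightarrow> real^'m) \<Rightarrow> nat \<Rightarrow> 'w measure" where
  "history M W i =
     sigma (space M) {W j k -` B \<inter> space M | j k B. j \<le> i \<and> B \<in> sets borel}"

section \<open>Model\<close>

text \<open>
  \<open>Xd k\<close> is the data distribution of agent \<open>k\<close>, and \<open>conn l k\<close> says that agents
  \<open>l\<close> and \<open>k\<close> are connected. The initial estimates may be random, with finite second
  moments; deterministic ones are the case of constant \<open>w0 k\<close>.
\<close>

definition diffusion_setting ::
  "'w measure \<Rightarrow> ('n \<Rightarrow> 'x measure) \<Rightarrow> ('n \<Rightarrow> nat \<Rightarrow> 'w \<Rightarrow> 'x)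
     \<Rightarrow> (real^'m \<Rightarrow> 'x \<Rightarrow> real) \<Rightarrow> ('n \<Rightarrow> real^'m \<Rightarrow> real)
     \<Rightarrow> ('n \<Rightarrow> 'n \<Rightarrow> bool) \<Rightarrow> real^'n^'n \<Rightarrow> ('n \<Rightarrow> 'w \<Rightarrow> real^'m) \<Rightarrow> bool" where
  "diffusion_setting M Xd x Q J conn A w0 \<longleftrightarrow>
     prob_space M \<and>
     (\<forall>k. \<forall>i\<ge>1. x k i \<in> measurable M (Xd k) \<and> distr M (Xd k) (x k i) = Xd k) \<and>
     (\<forall>k. prob_space.indep_vars M (\<lambda>_. Xd k) (x k) {1..}) \<and>
     (\<forall>k w. Q w \<in> borel_measurable (Xd k)) \<and>
     (\<forall>k w. \<forall>z\<in>space (Xd k). (\<lambda>u. Q u z) differentiable (at w)) \<and>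
     (\<forall>k w. \<forall>i\<ge>1. has_bochner_integral M (\<lambda>\<omega>. Q w (x k i \<omega>)) (J k w)) \<and>
     (\<forall>l k. 0 \<le> A $ l $ k) \<and>
     (\<forall>k. (\<Sum>l\<in>UNIV. A $ l $ k) = 1) \<and>
     (\<forall>l k. \<not> conn l k \<longrightarrow> A $ l $ k = 0) \<and>
     (\<forall>k. w0 k \<in> borel_measurable M \<and> integrable M (\<lambda>\<omega>. norm (w0 k \<omega>) ^ 2))"

definition risk_assumption ::
  "('n \<Rightarrow> real^'m \<Rightarrow> real) \<Rightarrow> real \<Rightarrow> real \<Rightarrow> real^'m \<Rightarrow> bool" where
  "risk_assumption J lam_lo lam_hi wo \<longleftrightarrow>
     (\<forall>k. twice_cont_diff (J k)) \<and>
     0 < lam_lo \<and> lam_lo \<le> lam_hi \<and>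
     (\<forall>k w. loewner_le (mat lam_lo) (hessian (J k) w) \<and>
            loewner_le (hessian (J k) w) (mat lam_hi)) \<and>
     (\<forall>k. is_arg_min (J k) (\<lambda>_. True) wo) \<and>
     (\<exists>\<epsilon>>0. \<exists>\<tau>. \<forall>k. 0 \<le> \<tau> k \<and>
        (\<forall>w. norm (wo - w) < \<epsilon> \<longrightarrow>
           mat_norm (hessian (J k) wo - hessian (J k) w) \<le> \<tau> k * norm (wo - w))) \<and>
     (\<exists>H. posdef H \<and> (\<forall>k. hessian (J k) wo = H))"

section \<open>Gradient noise\<close>

definition grad_noise ::
  "(real^'m \<Rightarrow> 'x \<Rightarrow> real) \<Rightarrow> ('n \<Rightarrow> real^'m \<Rightarrow> real) \<Rightarrow> ('n \<Rightarrow> nat \<Rightarrow> 'w \<Rightarrow> 'x)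
     \<Rightarrow> 'n \<Rightarrow> nat \<Rightarrow> real^'m \<Rightarrow> 'w \<Rightarrow> real^'m" where
  "grad_noise Q J x k i w \<omega> =
     gradient (\<lambda>u. Q u (x k i \<omega>)) w - gradient (J k) w"

text \<open>
  A vector \<open>col{w\<^sub>1,...,w\<^sub>N}\<close> is kept in block form \<open>(real^'m)^'n\<close>, whose norm is the
  Euclidean norm of the stacked vector. Only the noise is flattened, so that its
  covariance becomes a matrix indexed by (agent, coordinate).
\<close>

definition stacked_noise ::
  "('n \<Rightarrow> nat \<Rightarrow> real^'m \<Rightarrow> 'w \<Rightarrow> real^'m) \<Rightarrow> nat \<Rightarrow> (real^'m)^'n \<Rightarrow> 'w \<Rightarrow> real^('n \<times> 'm)"
  where
  "stacked_noise v i \<W> \<omega> = (\<chi> p. v (fst p) i (\<W> $ fst p) \<omega> $ snd p)"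

definition outer :: "real^'d \<Rightarrow> real^'d^'d" where
  "outer g = (\<chi> p q. g $ p * g $ q)"

text \<open>
  The library's \<open>real_cond_exp M G f\<close> is the difference of the conditional expectations
  of the positive and negative parts of \<open>f\<close>. It is therefore meaningful as soon as
  these are finite almost surely, even when \<open>f\<close> is not integrable.
\<close>

definition vec_cond_exp ::
  "'w measure \<Rightarrow> 'w measure \<Rightarrow> ('w \<Rightarrow> real^'m) \<Rightarrow> 'w \<Rightarrow> real^'m" where
  "vec_cond_exp M G f \<omega> = (\<chi> j. real_cond_exp M G (\<lambda>\<omega>'. f \<omega>' $ j) \<omega>)"

definition mat_cond_exp ::
  "'w measure \<Rightarrow> 'w measure \<Rightarrow> ('w \<Rightarrow> real^'d^'e) \<Rightarrow> 'w \<Rightarrow> real^'d^'e" where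
  "mat_cond_exp M G f \<omega> = (\<chi> p q. real_cond_exp M G (\<lambda>\<omega>'. f \<omega>' $ p $ q) \<omega>)"

definition noise_cov ::
  "'w measure \<Rightarrow> (nat \<Rightarrow> 'w measure) \<Rightarrow> ('n \<Rightarrow> nat \<Rightarrow> real^'m \<Rightarrow> 'w \<Rightarrow> real^'m)
     \<Rightarrow> nat \<Rightarrow> ('w \<Rightarrow> (real^'m)^'n) \<Rightarrow> 'w \<Rightarrow> real^('n \<times> 'm)^('n \<times> 'm)" where
  "noise_cov M F v i \<W> =
     mat_cond_exp M (F (i - 1)) (\<lambda>\<omega>. outer (stacked_noise v i (\<W> \<omega>) \<omega>))"

definition second_moment_bound ::
  "'w measure \<Rightarrow> (nat \<Rightarrow> 'w measure) \<Rightarrow> ('n \<Rightarrow> nat \<Rightarrow> real^'m \<Rightarrow> 'w \<Rightarrow> real^'m)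
     \<Rightarrow> real^'m \<Rightarrow> real \<Rightarrow> real \<Rightarrow> bool" where
  "second_moment_bound M F v wo \<alpha> \<sigma> \<longleftrightarrow>
     (\<forall>k. \<forall>i\<ge>1. \<forall>w\<in>borel_measurable (F (i - 1)). AE \<omega> in M.
        nn_cond_exp M (F (i - 1)) (\<lambda>\<omega>'. ennreal (norm (v k i (w \<omega>') \<omega>') ^ 2)) \<omega>
          \<le> ennreal (\<alpha> * norm (wo - w \<omega>) ^ 2 + \<sigma> ^ 2))"

definition fourth_moment_bound ::
  "'w measure \<Rightarrow> (nat \<Rightarrow> 'w measure) \<Rightarrow> ('n \<Rightarrow> nat \<Rightarrow> real^'m \<Rightarrow> 'w \<Rightarrow> real^'m)
     \<Rightarrow> real^'m \<Rightarrow> real \<Rightarrow> real \<Rightarrow> bool" where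
  "fourth_moment_bound M F v wo \<alpha> \<sigma> \<longleftrightarrow>
     (\<forall>k. \<forall>i\<ge>1. \<forall>w\<in>borel_measurable (F (i - 1)). AE \<omega> in M.
        nn_cond_exp M (F (i - 1)) (\<lambda>\<omega>'. ennreal (norm (v k i (w \<omega>') \<omega>') ^ 4)) \<omega>
          \<le> ennreal (\<alpha> * norm (wo - w \<omega>) ^ 4 + \<sigma> ^ 4))"

definition noise_assumption ::
  "'w measure \<Rightarrow> (nat \<Rightarrow> 'w measure) \<Rightarrow> ('n::finite \<Rightarrow> nat \<Rightarrow> real^'m \<Rightarrow> 'w \<Rightarrow> real^'m)
     \<Rightarrow> real^'m \<Rightarrow> bool" where
  "noise_assumption M F v wo \<longleftrightarrow>
     (\<forall>k. \<forall>i\<ge>1. \<forall>w\<in>borel_measurable (F (i - 1)). AE \<omega> in M.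
        vec_cond_exp M (F (i - 1)) (\<lambda>\<omega>'. v k i (w \<omega>') \<omega>') \<omega> = 0) \<and>
     (\<exists>\<alpha>\<ge>0. \<exists>\<sigma>. fourth_moment_bound M F v wo \<alpha> \<sigma>) \<and>
     (\<forall>k l. \<forall>i\<ge>1. k \<noteq> l \<longrightarrow>
        prob_space.expectation M (\<lambda>\<omega>. v k i wo \<omega> \<bullet> v l i wo \<omega>) = 0) \<and>
     (\<exists>\<kappa>\<ge>0. \<exists>\<gamma>. 0 < \<gamma> \<and> \<gamma> \<le> 4 \<and> (\<exists>\<epsilon>>0.
        \<forall>i\<ge>1. \<forall>\<W>\<in>borel_measurable (F (i - 1)). AE \<omega> in M.
          norm ((\<chi> k. wo) - \<W> \<omega>) \<le> \<epsilon> \<longrightarrow>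
            mat_norm (noise_cov M F v i \<W> \<omega> - noise_cov M F v i (\<lambda>_. \<chi> k. wo) \<omega>)
              \<le> \<kappa> * norm ((\<chi> k. wo) - \<W> \<omega>) powr \<gamma>)) \<and>
     convergent (\<lambda>i. prob_space.expectation M (noise_cov M F v i (\<lambda>_. \<chi> k. wo)))"

section \<open>Network topology\<close>

definition primitive_mat :: "real^'n^'n \<Rightarrow> bool" where
  "primitive_mat A \<longleftrightarrow> (\<exists>r>0. \<forall>l k. 0 < (((**) A) ^^ r) (mat 1) $ l $ k)"

definition topology_assumption ::
  "('n \<Rightarrow> 'n \<Rightarrow> bool) \<Rightarrow> real^'n^'n \<Rightarrow> real^'n \<Rightarrow> bool" where
  "topology_assumption conn A p \<longleftrightarrow>
     (\<forall>l k. conn\<^sup>*\<^sup>* l k) \<and>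
     primitive_mat A \<and>
     A *v p = p \<and> (\<Sum>k\<in>UNIV. p $ k) = 1 \<and> (\<forall>k. 0 < p $ k)"

end

theory Submission
  imports Defs "HOL-Real_Asymp.Real_Asymp"
begin

text \<open>
  Let \<open>e\<^sub>k = w\<^sup>o - w\<^sub>k\<close> be the error of agent \<open>k\<close> and let \<open>y\<^sub>l = e\<^sub>l + \<mu> \<nabla>J\<^sub>l(w\<^sub>l)\<close> be the
  error after a noise-free gradient step. One iteration of the diffusion strategy reads
  \<open>e'\<^sub>k = \<Sum>\<^sub>l a\<^sub>l\<^sub>k (y\<^sub>l + \<mu> v\<^sub>l)\<close>. Three facts drive everything. The weights form a convex
  combination, so averaging does not increase the largest \<open>r\<close>-th moment among the agents.
  Strong convexity, a Lipschitz gradient and the common minimizer give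
  \<open>\<parallel>y\<^sub>l\<parallel>\<^sup>2 \<le> (1 - 2\<lambda>\<mu> + L\<^sup>2\<mu>\<^sup>2) \<parallel>e\<^sub>l\<parallel>\<^sup>2\<close> with \<open>\<lambda>\<close> the lower bound of the Hessians. The noise is
  centred given the past, so the cross term \<open>y\<^sub>l \<bullet> v\<^sub>l\<close> has mean zero. Hence the largest second
  moment \<open>t\<close> satisfies \<open>t' \<le> (1 - 2\<lambda>\<mu> + C\<mu>\<^sup>2) t + \<sigma>\<^sup>2\<mu>\<^sup>2\<close>, a purely numerical recursion:
  \<open>contraction_eventually_le\<close> gives \<open>t \<longlonglongrightarrow> 0\<close>, and for step sizes \<open>\<mu>/i\<close> Chung's lemma
  (\<open>chung_rate\<close>) gives the rate \<open>1/i\<close> with the stated constant. The maximum over the agents, and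
  not a weighted sum, is what makes the same constant valid for each single agent.

  For almost sure convergence one needs a scalar process adapted to the whole network. The
  Perron vector provides it: as \<open>A p = p\<close>, averaging does not increase
  \<open>S = \<Sum>\<^sub>k p\<^sub>k \<parallel>e\<^sub>k\<parallel>\<^sup>2\<close>, and \<open>S\<close> plus the tail of the series \<open>\<sigma>\<^sup>2 \<Sum> \<mu>\<^sup>2\<close> is eventually a
  nonnegative supermartingale. Its mean is already known to tend to \<open>0\<close>, so the maximal
  inequality, applied from later and later starting times, forces it to tend to \<open>0\<close> almost
  surely (\<open>supermartingale_AE_tendsto_0\<close>).

  Fourth moments follow the same pattern. Expanding \<open>\<parallel>y + \<mu> v\<parallel>\<^sup>4\<close>, the term linear in \<open>v\<close> has
  mean zero, the contraction factor becomes \<open>1 - 4\<lambda>\<mu> + O(\<mu>\<^sup>2)\<close>, and the inhomogeneity is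
  \<open>O(\<mu>\<^sup>2 t + \<mu>\<^sup>4) = O(i\<^sup>-\<^sup>3)\<close> by the rate of the second moments; Chung's lemma gives \<open>O(i\<^sup>-\<^sup>2)\<close>.
\<close>

section \<open>Perturbed contractions of real sequences\<close>

text \<open>
  Unrolled from an index \<open>N\<close>, the recursion for \<open>t - d\<close> gains the factor
  \<open>\<Prod> (1 - c\<^sub>j) \<le> exp (- \<Sum> c\<^sub>j)\<close>, which tends to \<open>0\<close> since the series diverges.
\<close>

lemma contraction_eventually_le:
  fixes t c :: "nat \<Rightarrow> real"
  assumes step: "\<forall>\<^sub>F i in sequentially. t (Suc i) \<le> (1 - c i) * t i + c i * d"
    and c01: "\<forall>\<^sub>F i in sequentially. 0 \<le> c i \<and> c i \<le> 1"
    and c_sum: "filterlim (\<lambda>n. \<Sum>i<n. c i) at_top sequentially"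
    and "d < D"
  shows "\<forall>\<^sub>F i in sequentially. t i \<le> D"
proof -
  obtain N where N: "\<And>i. i \<ge> N \<Longrightarrow> t (Suc i) \<le> (1 - c i) * t i + c i * d"
      "\<And>i. i \<ge> N \<Longrightarrow> 0 \<le> c i \<and> c i \<le> 1"
    using eventually_conj[OF step c01] unfolding eventually_sequentially by blast
  define K where "K = \<bar>t N - d\<bar>"
  define S where "S i = (\<Sum>j<i. c j)" for i
  have bound: "t i - d \<le> K * exp (S N - S i)" if "i \<ge> N" for i
    using that
  proof (induction i rule: dec_induct)
    case base
    then show ?case by (simp add: K_def)
  next
    case (step i)
    have c: "0 \<le> c i" "c i \<le> 1" using N(2) step by auto
    have "t (Suc i) - d \<le> (1 - c i) * (t i - d)"
      using N(1)[of i] step by (simp add: algebra_simps)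
    also have "\<dots> \<le> (1 - c i) * (K * exp (S N - S i))"
      using step c by (intro mult_left_mono) auto
    also have "\<dots> \<le> exp (- c i) * (K * exp (S N - S i))"
      using exp_ge_add_one_self[of "- c i"] by (intro mult_right_mono) (auto simp: K_def)
    also have "\<dots> = K * exp (S N - S (Suc i))"
      by (simp add: S_def algebra_simps flip: exp_add)
    finally show ?case .
  qed
  have "((\<lambda>i. K * exp (S N - S i)) \<longlongrightarrow> K * 0) sequentially"
  proof (intro tendsto_intros filterlim_compose[OF exp_at_bot])
    have "filterlim (\<lambda>i. - S N + S i) at_top sequentially"
      using c_sum unfolding S_def by (intro filterlim_tendsto_add_at_top[OF tendsto_const])
    then show "filterlim (\<lambda>i. S N - S i) at_bot sequentially"
      by (subst filterlim_uminus_at_top[symmetric, of "\<lambda>i. S i - S N", simplified]) simp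
  qed
  then have "\<forall>\<^sub>F i in sequentially. K * exp (S N - S i) < D - d"
    using \<open>d < D\<close> by (intro order_tendstoD) auto
  with eventually_ge_at_top[of N] show ?thesis
    by eventually_elim (use bound in fastforce)
qed

text \<open>
  Chung's lemma. Passing from \<open>t\<^sub>i\<close> to \<open>i\<^sup>r t\<^sub>i\<close> multiplies the coefficient by
  \<open>(1 + 1/i)\<^sup>r = 1 + r/i + O(1/i\<^sup>2)\<close>, so the contraction rate \<open>a/i\<close> drops to \<open>(a - r)/i\<close>, while
  the inhomogeneity becomes \<open>b/i\<close>. For each \<open>q < a - r\<close> the rescaled sequence is eventually
  contracted at the rate \<open>q/i\<close> towards the fixed point \<open>b/q\<close>.
\<close>

lemma chung_rate:
  fixes t :: "nat \<Rightarrow> real"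
  assumes step: "\<forall>\<^sub>F i in sequentially.
      t (Suc i) \<le> (1 - a / real (Suc i) + C / real (Suc i) ^ 2) * t i + b / real (Suc i) ^ Suc r"
    and nonneg: "\<And>i. 0 \<le> t i" and "0 \<le> b" "real r < a" "b / (a - real r) < D"
  shows "\<forall>\<^sub>F i in sequentially. real i ^ r * t i \<le> D"
proof -
  \<comment> \<open>a rate \<open>q\<close> so close to \<open>a - r\<close> that the fixed point \<open>b / q\<close> still lies below \<open>D\<close>\<close>
  have "((\<lambda>q. b / q) \<longlongrightarrow> b / (a - real r)) (at_left (a - real r))"
    using assms by (auto intro!: tendsto_intros)
  then have "\<forall>\<^sub>F q in at_left (a - real r). b / q < D"
    using assms by (intro order_tendstoD)
  moreover have "\<forall>\<^sub>F q in at_left (a - real r). q \<in> {0<..<a - real r}"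
    using assms by (intro eventually_at_left_real) auto
  ultimately have "\<forall>\<^sub>F q in at_left (a - real r). b / q < D \<and> q \<in> {0<..<a - real r}"
    by eventually_elim auto
  then obtain q where q: "0 < q" "q < a - real r" "b / q < D"
    using eventually_happens'[of "at_left (a - real r)"] by (auto simp: trivial_limit_at_left_real)
  have "((\<lambda>i. real (Suc i) * (1 - (1 + 1 / real i) powr real r *
            (1 - a / real (Suc i) + C / real (Suc i) ^ 2))) \<longlongrightarrow> a - real r) sequentially"
    by real_asymp
  then have "\<forall>\<^sub>F i in sequentially. q < real (Suc i) * (1 - (1 + 1 / real i) powr real r *
            (1 - a / real (Suc i) + C / real (Suc i) ^ 2))"
    using q by (intro order_tendstoD)
  then have coeff: "\<forall>\<^sub>F i in sequentially. (real (Suc i) / real i) ^ r *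
            (1 - a / real (Suc i) + C / real (Suc i) ^ 2) \<le> 1 - q / real (Suc i)"
    using eventually_gt_at_top[of 0]
  proof eventually_elim
    case (elim i)
    have "1 + 1 / real i = real (Suc i) / real i" using elim by (simp add: field_simps)
    moreover have "(1 + 1 / real i) powr real r = (1 + 1 / real i) ^ r"
      using elim by (subst powr_realpow) (auto intro!: add_pos_nonneg)
    ultimately have "q < real (Suc i) * (1 - (real (Suc i) / real i) ^ r *
        (1 - a / real (Suc i) + C / real (Suc i) ^ 2))" (is "_ < _ * (1 - ?x)")
      using elim by metis
    then have "q / real (Suc i) < 1 - ?x"
      by (subst pos_divide_less_eq) (simp_all only: mult.commute of_nat_0_less_iff zero_less_Suc)
    then show ?case by linarith
  qed
  show ?thesis
  proof (rule contraction_eventually_le)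
    show "\<forall>\<^sub>F i in sequentially. real (Suc i) ^ r * t (Suc i)
        \<le> (1 - q / real (Suc i)) * (real i ^ r * t i) + q / real (Suc i) * (b / q)"
      using step coeff eventually_gt_at_top[of 0]
    proof eventually_elim
      case (elim i)
      let ?c = "1 - a / real (Suc i) + C / real (Suc i) ^ 2"
      have "real (Suc i) ^ r * t (Suc i) \<le> real (Suc i) ^ r * (?c * t i + b / real (Suc i) ^ Suc r)"
        using elim by (intro mult_left_mono) auto
      also have "\<dots> = ((real (Suc i) / real i) ^ r * ?c) * (real i ^ r * t i) + b / real (Suc i)"
      proof -
        have *: "X * (c * u + b / (s * X)) = ((X / y) * c) * (y * u) + b / s"
          if "X \<noteq> 0" "y \<noteq> 0" "s \<noteq> 0" for X y c u s :: real
          using that by (simp add: field_simps)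
        show ?thesis
          unfolding power_divide power_Suc by (rule *) (use elim in auto)
      qed
      also have "\<dots> \<le> (1 - q / real (Suc i)) * (real i ^ r * t i) + b / real (Suc i)"
        using elim nonneg by (intro add_right_mono mult_right_mono) auto
      finally show ?case using q by simp
    qed
    show "\<forall>\<^sub>F i in sequentially. 0 \<le> q / real (Suc i) \<and> q / real (Suc i) \<le> 1"
      using eventually_ge_at_top[of "nat \<lceil>q\<rceil>"]
      by eventually_elim (use q in \<open>auto simp: field_simps\<close>)
    have "filterlim (\<lambda>n. q * harm n) at_top sequentially"
      using harm_at_top q by (intro filterlim_tendsto_pos_mult_at_top[OF tendsto_const])
    moreover have "q * harm n = (\<Sum>i<n. q / real (Suc i))" for n
      by (simp add: harm_altdef sum_distrib_left divide_inverse)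
    ultimately show "filterlim (\<lambda>n. \<Sum>i<n. q / real (Suc i)) at_top sequentially"
      by simp
    show "b / q < D" by (fact q)
  qed
qed

section \<open>Gradients of strongly convex functions\<close>

text \<open>
  By the Riesz representation in coordinates, the definite description that defines the
  gradient is met by exactly one vector as soon as \<open>f\<close> is differentiable.
\<close>

lemma gderiv_gradient:
  fixes f :: "real^'m::finite \<Rightarrow> real"
  assumes "f differentiable (at w)"
  shows "GDERIV f w :> gradient f w"
proof -
  obtain f' where f': "(f has_derivative f') (at w)"
    using assms by (auto simp: differentiable_def)
  interpret f': bounded_linear f' using f' by (rule has_derivative_bounded_linear)
  define D where "D = (\<Sum>b\<in>Basis. f' b *\<^sub>R b)"
  have "f' h = h \<bullet> D" for h
  proof -
    have "f' h = f' (\<Sum>b\<in>Basis. (h \<bullet> b) *\<^sub>R b)" by (simp add: euclidean_representation)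
    also have "\<dots> = h \<bullet> D" by (simp add: f'.sum f'.scaleR D_def inner_sum_right mult.commute)
    finally show ?thesis .
  qed
  then have "f' = (\<lambda>h. h \<bullet> D)" by (rule ext)
  then have D: "GDERIV f w :> D" using f' by (simp add: gderiv_def)
  have "D' = D" if "GDERIV f w :> D'" for D'
  proof -
    have "(\<lambda>h. h \<bullet> D') = (\<lambda>h. h \<bullet> D)"
      using that D unfolding gderiv_def by (rule has_derivative_unique)
    then have "(D' - D) \<bullet> (D' - D) = 0" by (metis inner_diff_right right_minus_eq)
    then show ?thesis by simp
  qed
  with D show ?thesis unfolding gradient_def by (rule theI)
qed

lemma gradient_zero_at_min:
  fixes f :: "real^'m::finite \<Rightarrow> real"
  assumes "f differentiable (at w)" and "is_arg_min f (\<lambda>_. True) w"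
  shows "gradient f w = 0"
proof -
  have "(\<lambda>h. h \<bullet> gradient f w) = (\<lambda>h. 0)"
    using gderiv_gradient[OF assms(1)] assms(2) unfolding gderiv_def
    by (intro differential_zero_maxmin[of w UNIV f])
      (auto simp: is_arg_min_linorder)
  then have "gradient f w \<bullet> gradient f w = 0" by metis
  then show ?thesis by simp
qed

text \<open>
  Exhibits the gradient as a limit of countably many values of \<open>f\<close>; this is the
  source of its measurability in a parameter.
\<close>

lemma gradient_difference_quotient:
  fixes f :: "real^'m::finite \<Rightarrow> real"
  assumes "f differentiable (at w)"
  shows "(\<lambda>n. real (Suc n) * (f (w + inverse (real (Suc n)) *\<^sub>R axis j 1) - f w))
           \<longlonglongrightarrow> gradient f w $ j"
proof -
  have "((\<lambda>t. f (w + t *\<^sub>R axis j 1)) has_derivative (\<lambda>t. (t *\<^sub>R axis j 1) \<bullet> gradient f w)) (at 0)"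
    by (rule has_derivative_compose[of "\<lambda>t. w + t *\<^sub>R axis j 1" _ _ UNIV f, simplified])
      (use gderiv_gradient[OF assms] in \<open>auto simp: gderiv_def intro!: derivative_eq_intros\<close>)
  then have "((\<lambda>t. f (w + t *\<^sub>R axis j 1)) has_real_derivative gradient f w $ j) (at 0)"
    by (simp add: has_field_derivative_def inner_axis' mult.commute[of _ "gradient f w $ j"])
  then have lim: "((\<lambda>t. (f (w + t *\<^sub>R axis j 1) - f w) / t) \<longlongrightarrow> gradient f w $ j) (at 0)"
    by (simp add: has_field_derivative_iff)
  have "filterlim (\<lambda>n. inverse (real (Suc n))) (at 0) sequentially"
    using LIMSEQ_inverse_real_of_nat by (auto simp: filterlim_at)
  from filterlim_compose[OF lim this] show ?thesis
    by (simp add: field_simps)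
qed

lemma quadratic_form_ge_of_loewner:
  assumes "loewner_le (mat c) B"
  shows "c * (norm z)\<^sup>2 \<le> z \<bullet> (B *v z)"
proof -
  have "0 \<le> z \<bullet> (B *v z - mat c *v z)"
    using assms by (simp add: loewner_le_def psd_def matrix_vector_mult_diff_rdistrib)
  moreover have "mat c *v z = c *\<^sub>R z"
    by (simp add: vec_eq_iff matrix_vector_mult_def mat_def if_distrib if_distribR cong: if_cong)
  ultimately show ?thesis by (simp add: inner_diff_right dot_square_norm)
qed

lemma quadratic_form_le_of_loewner:
  assumes "loewner_le B (mat c)"
  shows "z \<bullet> (B *v z) \<le> c * (norm z)\<^sup>2"
proof -
  have "0 \<le> z \<bullet> (mat c *v z - B *v z)"
    using assms by (simp add: loewner_le_def psd_def matrix_vector_mult_diff_rdistrib)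
  moreover have "mat c *v z = c *\<^sub>R z"
    by (simp add: vec_eq_iff matrix_vector_mult_def mat_def if_distrib if_distribR cong: if_cong)
  ultimately show ?thesis by (simp add: inner_diff_right dot_square_norm)
qed

lemma symmetric_of_loewner:
  assumes "loewner_le (mat c) B"
  shows "transpose B = B"
proof -
  have "transpose (B - mat c) $ i $ j = (B - mat c) $ i $ j" for i j
    using assms by (simp add: loewner_le_def psd_def)
  then have "B $ j $ i = B $ i $ j" if "i \<noteq> j" for i j
    using that by (simp add: transpose_def mat_def) (metis diff_zero)
  then have "B $ j $ i = B $ i $ j" for i j
    by (cases "i = j") simp_all
  then show ?thesis by (simp add: vec_eq_iff transpose_def)
qed

text \<open>
  Polarization: if \<open>x\<close> has the direction of \<open>B y\<close> and the length of \<open>y\<close>, then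
  \<open>2 \<parallel>y\<parallel> \<parallel>B y\<parallel> = 2 x \<bullet> B y\<close> is at most the value of the quadratic form at \<open>x + y\<close>.
  The sharp bound is \<open>c \<parallel>y\<parallel>\<close>, but any Lipschitz constant serves for the
  gradient: it enters the recursion only at second order in the step size.
\<close>

lemma norm_matrix_le_of_loewner:
  fixes B :: "real^'m::finite^'m"
  assumes lower: "loewner_le (mat a) B" "0 \<le> a" and upper: "loewner_le B (mat c)"
  shows "norm (B *v y) \<le> 2 * c * norm y"
proof -
  have lo: "0 \<le> z \<bullet> (B *v z)" for z
    using quadratic_form_ge_of_loewner[OF lower(1), of z] lower(2)
    by (meson mult_nonneg_nonneg order_trans zero_le_power2)
  note hi = quadratic_form_le_of_loewner[OF upper]
  have c: "0 \<le> c"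
    using order_trans[OF lo hi, of "axis undefined 1"] by simp
  have sym: "u \<bullet> (B *v z) = z \<bullet> (B *v u)" for u z
    using symmetric_of_loewner[OF lower(1)]
    by (metis dot_lmul_matrix inner_commute transpose_matrix_vector)
  show ?thesis
  proof (cases "B *v y = 0")
    case True
    then show ?thesis using c by simp
  next
    case False
    define x where "x = (norm y / norm (B *v y)) *\<^sub>R (B *v y)"
    have nx: "norm x = norm y" using False by (simp add: x_def)
    have "x \<bullet> (B *v y) = norm y * norm (B *v y)"
      using False by (simp add: x_def dot_square_norm power2_eq_square)
    moreover have "2 * (x \<bullet> (B *v y)) \<le> (x + y) \<bullet> (B *v (x + y))"
      using lo[of x] lo[of y] sym[of x y]
      by (simp add: matrix_vector_right_distrib inner_add_left inner_add_right)
    moreover have "(x + y) \<bullet> (B *v (x + y)) \<le> c * (norm (x + y))\<^sup>2" by (rule hi)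
    moreover have "c * (norm (x + y))\<^sup>2 \<le> c * (4 * (norm y)\<^sup>2)"
    proof (rule mult_left_mono[OF _ c])
      have "norm (x + y) \<le> 2 * norm y" using norm_triangle_ineq[of x y] nx by simp
      then have "(norm (x + y))\<^sup>2 \<le> (2 * norm y)\<^sup>2" by (intro power_mono) auto
      then show "(norm (x + y))\<^sup>2 \<le> 4 * (norm y)\<^sup>2" by (simp add: power_mult_distrib)
    qed
    ultimately have "2 * (norm y * norm (B *v y)) \<le> c * (4 * (norm y)\<^sup>2)"
      by linarith
    also have "\<dots> = 2 * (norm y * (2 * c * norm y))"
      by (simp add: power2_eq_square)
    finally have "norm y * norm (B *v y) \<le> norm y * (2 * c * norm y)"
      by linarith
    moreover have "0 < norm y" using False by auto
    ultimately show ?thesis by (metis mult_le_cancel_left_pos)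
  qed
qed

lemma gradient_has_hessian:
  assumes "twice_cont_diff f"
  shows "(gradient f has_derivative (\<lambda>h. hessian f w *v h)) (at w)"
  unfolding hessian_def
  by (rule jacobian_works[THEN iffD1]) (use assms in \<open>simp add: twice_cont_diff_def\<close>)

text \<open>
  Since the gradient vanishes at the minimizer, both bounds follow from the mean value
  theorem on the segment from \<open>wo\<close> to \<open>w\<close>: for the first one it is applied to the scalar
  function \<open>t \<mapsto> (w - wo) \<bullet> \<nabla>f(wo + t (w - wo))\<close>.
\<close>

lemma gradient_strongly_monotone_lipschitz:
  fixes f :: "real^'m::finite \<Rightarrow> real"
  assumes f: "twice_cont_diff f"
    and lo: "\<And>w. loewner_le (mat lam) (hessian f w)"
    and hi: "\<And>w. loewner_le (hessian f w) (mat c)"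
    and "0 \<le> lam" and min: "is_arg_min f (\<lambda>_. True) wo"
  shows "lam * (norm (w - wo))\<^sup>2 \<le> (w - wo) \<bullet> gradient f w"
    and "norm (gradient f w) \<le> 2 * c * norm (w - wo)"
proof -
  note lam = quadratic_form_ge_of_loewner[OF lo]
  have grad0: "gradient f wo = 0"
    using gradient_zero_at_min[OF _ min] f by (simp add: twice_cont_diff_def)
  have "((\<lambda>t. (w - wo) \<bullet> gradient f (wo + t *\<^sub>R (w - wo))) has_real_derivative
          (w - wo) \<bullet> (hessian f (wo + t *\<^sub>R (w - wo)) *v (w - wo))) (at t)" for t
  proof -
    have "((\<lambda>t. gradient f (wo + t *\<^sub>R (w - wo))) has_derivative
            (\<lambda>s. hessian f (wo + t *\<^sub>R (w - wo)) *v (s *\<^sub>R (w - wo)))) (at t)"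
      by (rule has_derivative_compose[OF _ gradient_has_hessian[OF f]])
        (auto intro!: derivative_eq_intros)
    then have "((\<lambda>t. (w - wo) \<bullet> gradient f (wo + t *\<^sub>R (w - wo))) has_derivative
            (\<lambda>s. (w - wo) \<bullet> (hessian f (wo + t *\<^sub>R (w - wo)) *v (s *\<^sub>R (w - wo))))) (at t)"
      by (rule has_derivative_inner_right)
    moreover have "(\<lambda>s. (w - wo) \<bullet> (hessian f (wo + t *\<^sub>R (w - wo)) *v (s *\<^sub>R (w - wo))))
        = (*) ((w - wo) \<bullet> (hessian f (wo + t *\<^sub>R (w - wo)) *v (w - wo)))"
      by (auto simp: matrix_vector_mult_scaleR)
    ultimately show ?thesis
      by (simp add: has_field_derivative_def)
  qed
  from MVT2[of 0 1, OF _ this] obtain s where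
    "(w - wo) \<bullet> gradient f (wo + 1 *\<^sub>R (w - wo)) - (w - wo) \<bullet> gradient f (wo + 0 *\<^sub>R (w - wo))
      = (1 - 0) * ((w - wo) \<bullet> (hessian f (wo + s *\<^sub>R (w - wo)) *v (w - wo)))"
    by auto
  with lam[of "w - wo" "wo + s *\<^sub>R (w - wo)"] grad0 show "lam * (norm (w - wo))\<^sup>2 \<le> (w - wo) \<bullet> gradient f w"
    by simp
  have "norm (gradient f w - gradient f wo) \<le> 2 * c * norm (w - wo)"
    by (rule differentiable_bound[OF convex_UNIV])
      (use gradient_has_hessian[OF f] norm_matrix_le_of_loewner[OF lo \<open>0 \<le> lam\<close> hi] in \<open>auto intro!: onorm_le\<close>)
  with grad0 show "norm (gradient f w) \<le> 2 * c * norm (w - wo)" by simp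
qed

lemma gradient_step_contracts:
  fixes g :: "'a::real_inner"
  assumes "lam * (norm (w - wo))\<^sup>2 \<le> (w - wo) \<bullet> g" "norm g \<le> L * norm (w - wo)" "0 \<le> m"
  shows "(norm (wo - w + m *\<^sub>R g))\<^sup>2 \<le> (1 - 2 * lam * m + L\<^sup>2 * m\<^sup>2) * (norm (wo - w))\<^sup>2"
proof -
  have "(norm (wo - w + m *\<^sub>R g))\<^sup>2 = (norm (wo - w))\<^sup>2 - 2 * m * ((w - wo) \<bullet> g) + m\<^sup>2 * (norm g)\<^sup>2"
    unfolding power2_norm_eq_inner
    by (simp add: inner_add_left inner_add_right inner_diff_left inner_diff_right inner_commute
        power2_eq_square algebra_simps)
  moreover have "m * (lam * (norm (w - wo))\<^sup>2) \<le> m * ((w - wo) \<bullet> g)"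
    using assms by (intro mult_left_mono)
  moreover have "m\<^sup>2 * (norm g)\<^sup>2 \<le> m\<^sup>2 * (L * norm (w - wo))\<^sup>2"
    using assms by (intro mult_left_mono power_mono) auto
  ultimately show ?thesis
    by (simp add: norm_minus_commute algebra_simps power_mult_distrib)
qed

section \<open>Measurability of random gradients\<close>

text \<open>
  A function measurable in the sample and continuous in the parameter may be evaluated
  at a random parameter: for a simple random parameter this is a finite case distinction, and
  simple functions approximate the general case pointwise.
\<close>

lemma measurable_caratheodory:
  fixes g :: "'a::{metric_space, second_countable_topology} \<Rightarrow> 'x \<Rightarrow> 'b::metric_space"
  assumes g: "\<And>u. g u \<in> borel_measurable X"
    and cont: "\<And>z. z \<in> space X \<Longrightarrow> continuous_on UNIV (\<lambda>u. g u z)"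
    and w: "w \<in> borel_measurable M" and x: "x \<in> measurable M X"
  shows "(\<lambda>\<omega>. g (w \<omega>) (x \<omega>)) \<in> borel_measurable M"
proof -
  obtain S where S: "\<And>n. simple_function M (S n)" "\<And>\<omega>. \<omega> \<in> space M \<Longrightarrow> (\<lambda>n. S n \<omega>) \<longlonglongrightarrow> w \<omega>"
    using borel_measurable_implies_sequence_metric[OF w] by blast
  have "(\<lambda>\<omega>. g (S n \<omega>) (x \<omega>)) \<in> borel_measurable M" for n
  proof (rule measurable_compose_countable'[where I = "S n ` space M"])
    show "(\<lambda>\<omega>. g i (x \<omega>)) \<in> borel_measurable M" for i
      using measurable_compose[OF x g] .
    show "S n \<in> measurable M (count_space (S n ` space M))"
      using S(1)[of n] by (auto simp: simple_function_def measurable_count_space_eq2)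
    show "countable (S n ` space M)"
      using S(1)[of n] by (auto simp: simple_function_def countable_finite)
  qed
  then show ?thesis
  proof (rule borel_measurable_LIMSEQ_metric)
    fix \<omega> assume \<omega>: "\<omega> \<in> space M"
    then have "x \<omega> \<in> space X" using x by (rule measurable_space[rotated])
    then have "isCont (\<lambda>u. g u (x \<omega>)) (w \<omega>)"
      using cont by (simp add: continuous_on_eq_continuous_at)
    from isCont_tendsto_compose[OF this S(2)[OF \<omega>]]
    show "(\<lambda>n. g (S n \<omega>) (x \<omega>)) \<longlonglongrightarrow> g (w \<omega>) (x \<omega>)" .
  qed
qed

lemma borel_measurable_vecI:
  fixes f :: "'w \<Rightarrow> real^'m::finite"
  assumes "\<And>j. (\<lambda>\<omega>. f \<omega> $ j) \<in> borel_measurable M"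
  shows "f \<in> borel_measurable M"
proof (rule borel_measurable_euclidean_space[THEN iffD2], rule ballI)
  fix b :: "real^'m" assume "b \<in> Basis"
  then obtain j where "b = axis j 1" by (auto simp: Basis_vec_def)
  then have "(\<lambda>\<omega>. f \<omega> \<bullet> b) = (\<lambda>\<omega>. f \<omega> $ j)" by (simp add: inner_axis)
  with assms[of j] show "(\<lambda>\<omega>. f \<omega> \<bullet> b) \<in> borel_measurable M" by (simp only:)
qed

lemma measurable_gradient_caratheodory:
  fixes Q :: "real^'m::finite \<Rightarrow> 'x \<Rightarrow> real"
  assumes Q: "\<And>u. Q u \<in> borel_measurable X"
    and diff: "\<And>z u. z \<in> space X \<Longrightarrow> (\<lambda>u. Q u z) differentiable (at u)"
    and w: "w \<in> borel_measurable M" and x: "x \<in> measurable M X"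
  shows "(\<lambda>\<omega>. gradient (\<lambda>u. Q u (x \<omega>)) (w \<omega>)) \<in> borel_measurable M"
proof -
  have "continuous_on UNIV (\<lambda>u. Q u z)" if "z \<in> space X" for z
    using diff[OF that] by (intro differentiable_imp_continuous_on) (simp add: differentiable_on_def)
  note Q_cont = this
  have Q_meas: "(\<lambda>\<omega>. Q (u \<omega>) (x \<omega>)) \<in> borel_measurable M"
    if "u \<in> borel_measurable M" for u
    by (rule measurable_caratheodory[OF Q _ that x]) (rule Q_cont)
  show ?thesis
  proof (rule borel_measurable_vecI)
    fix j
    let ?q = "\<lambda>n \<omega>. real (Suc n) *
        (Q (w \<omega> + inverse (real (Suc n)) *\<^sub>R axis j 1) (x \<omega>) - Q (w \<omega>) (x \<omega>))"
    show "(\<lambda>\<omega>. gradient (\<lambda>u. Q u (x \<omega>)) (w \<omega>) $ j) \<in> borel_measurable M"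
    proof (rule borel_measurable_LIMSEQ_metric[where f = ?q])
      show "?q n \<in> borel_measurable M" for n
        using w by (intro borel_measurable_times borel_measurable_diff Q_meas) auto
      fix \<omega> assume "\<omega> \<in> space M"
      then have "x \<omega> \<in> space X" using x by (rule measurable_space[rotated])
      then show "(\<lambda>n. ?q n \<omega>) \<longlonglongrightarrow> gradient (\<lambda>u. Q u (x \<omega>)) (w \<omega>) $ j"
        by (intro gradient_difference_quotient diff)
    qed
  qed
qed

section \<open>Conditional moments and supermartingales\<close>

lemma convex_combination_norm_power:
  fixes z :: "'n::finite \<Rightarrow> 'a::real_normed_vector"
  assumes "\<And>l. 0 \<le> a l" "(\<Sum>l\<in>UNIV. a l) = 1" and "even r"
  shows "norm (\<Sum>l\<in>UNIV. a l *\<^sub>R z l) ^ r \<le> (\<Sum>l\<in>UNIV. a l * norm (z l) ^ r)"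
proof -
  have "norm (\<Sum>l\<in>UNIV. a l *\<^sub>R z l) \<le> (\<Sum>l\<in>UNIV. a l * norm (z l))"
    by (rule order_trans[OF norm_sum]) (simp add: assms)
  then have "norm (\<Sum>l\<in>UNIV. a l *\<^sub>R z l) ^ r \<le> (\<Sum>l\<in>UNIV. a l *\<^sub>R norm (z l)) ^ r"
    by (intro power_mono) auto
  also have "\<dots> \<le> (\<Sum>l\<in>UNIV. a l * norm (z l) ^ r)"
    by (rule convex_on_sum[OF _ _ convex_power_even[OF \<open>even r\<close>]]) (auto simp: assms)
  finally show ?thesis .
qed

text \<open>
  The term linear in \<open>y \<bullet> z\<close> is kept exactly, because it will have mean zero. All other
  mixed terms are absorbed by \<open>\<bar>y \<bullet> z\<bar> \<le> \<parallel>y\<parallel> \<parallel>z\<parallel>\<close> and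
  \<open>2 \<parallel>y\<parallel> \<parallel>z\<parallel> \<le> \<parallel>y\<parallel>\<^sup>2 + \<parallel>z\<parallel>\<^sup>2\<close>.
\<close>

lemma norm_add_power4_le:
  fixes y z :: "'a::real_inner"
  shows "norm (y + z) ^ 4 \<le> norm y ^ 4 + 4 * (norm y)\<^sup>2 * (y \<bullet> z)
           + 8 * (norm y)\<^sup>2 * (norm z)\<^sup>2 + 3 * norm z ^ 4"
proof -
  define P R c where "P = norm y" and "R = norm z" and "c = y \<bullet> z"
  have c: "\<bar>c\<bar> \<le> P * R" unfolding c_def P_def R_def by (rule Cauchy_Schwarz_ineq2)
  have "norm (y + z) ^ 4 = ((norm (y + z))\<^sup>2)\<^sup>2" by simp
  also have "(norm (y + z))\<^sup>2 = P\<^sup>2 + 2 * c + R\<^sup>2"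
    unfolding P_def R_def c_def power2_norm_eq_inner
    by (simp add: inner_add_left inner_add_right inner_commute)
  also have "(P\<^sup>2 + 2 * c + R\<^sup>2)\<^sup>2
      = P ^ 4 + 4 * P\<^sup>2 * c + 4 * c\<^sup>2 + 2 * P\<^sup>2 * R\<^sup>2 + 4 * c * R\<^sup>2 + R ^ 4"
    by (simp add: power2_eq_square power4_eq_xxxx algebra_simps)
  also have "4 * c\<^sup>2 \<le> 4 * P\<^sup>2 * R\<^sup>2"
    using power_mono[OF c, of 2] by (simp add: power_mult_distrib)
  also have "4 * c * R\<^sup>2 \<le> 4 * (P * R) * R\<^sup>2"
    using c by (intro mult_right_mono mult_left_mono) auto
  also have "4 * (P * R) * R\<^sup>2 \<le> 2 * P\<^sup>2 * R\<^sup>2 + 2 * R ^ 4"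
  proof -
    have "0 \<le> 2 * (R * (P - R))\<^sup>2" by simp
    then show ?thesis by (simp add: power2_eq_square power4_eq_xxxx algebra_simps)
  qed
  finally show ?thesis
    unfolding P_def[symmetric] R_def[symmetric] c_def[symmetric] by simp
qed

context sigma_finite_subalgebra
begin

text \<open>
  Turns a bound on a conditional moment into one on a weighted moment. The weight \<open>f\<close>
  will be an indicator of a past event, or the squared norm of the drift term, which is
  unbounded; this is why integrability of the product is a conclusion.
\<close>

lemma integral_le_of_cond_bound:
  fixes f g h :: "'a \<Rightarrow> real"
  assumes f: "f \<in> borel_measurable F" and g: "g \<in> borel_measurable M"
    and pos: "\<And>x. 0 \<le> f x" "\<And>x. 0 \<le> g x" "\<And>x. 0 \<le> h x"
    and bound: "AE x in M. nn_cond_exp M F (\<lambda>x. ennreal (g x)) x \<le> ennreal (h x)"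
    and int: "integrable M (\<lambda>x. f x * h x)"
  shows "integrable M (\<lambda>x. f x * g x)"
    and "(\<integral>x. f x * g x \<partial>M) \<le> (\<integral>x. f x * h x \<partial>M)"
proof -
  have fM: "f \<in> borel_measurable M" by (rule measurable_from_subalg[OF subalg f])
  have "(\<integral>\<^sup>+x. ennreal (f x * g x) \<partial>M) = (\<integral>\<^sup>+x. ennreal (f x) * ennreal (g x) \<partial>M)"
    using pos by (simp add: ennreal_mult)
  also have "\<dots> = (\<integral>\<^sup>+x. ennreal (f x) * nn_cond_exp M F (\<lambda>x. ennreal (g x)) x \<partial>M)"
    by (rule nn_cond_exp_intg[symmetric]) (use f g in auto)
  also have "\<dots> \<le> (\<integral>\<^sup>+x. ennreal (f x * h x) \<partial>M)"
  proof (rule nn_integral_mono_AE)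
    show "AE x in M. ennreal (f x) * nn_cond_exp M F (\<lambda>x. ennreal (g x)) x \<le> ennreal (f x * h x)"
      using bound by eventually_elim (simp add: ennreal_mult pos mult_left_mono)
  qed
  also have "\<dots> = ennreal (\<integral>x. f x * h x \<partial>M)"
    using int pos by (intro nn_integral_eq_integral) auto
  finally have le: "(\<integral>\<^sup>+x. ennreal (f x * g x) \<partial>M) \<le> ennreal (\<integral>x. f x * h x \<partial>M)" .
  show *: "integrable M (\<lambda>x. f x * g x)"
    by (rule integrableI_nonneg) (use fM g pos le in \<open>auto simp: less_top[symmetric] top_unique\<close>)
  have "(\<integral>\<^sup>+x. ennreal (f x * g x) \<partial>M) = ennreal (\<integral>x. f x * g x \<partial>M)"
    using * pos by (intro nn_integral_eq_integral) auto
  with le show "(\<integral>x. f x * g x \<partial>M) \<le> (\<integral>x. f x * h x \<partial>M)"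
    using pos by (simp add: integral_nonneg_AE)
qed

text \<open>
  Coordinatewise, a factor known from the past may be moved into the conditional
  expectation. Integrability is that of the product, because \<open>Y\<close> will also be cubic in the
  error, where the fourth moments of error and noise only bound the product.
\<close>

lemma centered_inner_integral_zero:
  fixes V Y :: "'a \<Rightarrow> real^'m::finite"
  assumes V: "V \<in> borel_measurable M" and Y: "Y \<in> borel_measurable F"
    and centered: "AE x in M. vec_cond_exp M F V x = 0"
    and int: "integrable M (\<lambda>x. norm (Y x) * norm (V x))"
  shows "integrable M (\<lambda>x. Y x \<bullet> V x)" and "(\<integral>x. Y x \<bullet> V x \<partial>M) = 0"
proof -
  have YM: "Y \<in> borel_measurable M" by (rule measurable_from_subalg[OF subalg Y])
  have nth: "(\<lambda>x. f x $ j) \<in> borel_measurable N" if "f \<in> borel_measurable N"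
    for f :: "'a \<Rightarrow> real^'m" and N :: "'a measure" and j
    using that by (rule measurable_compose) simp
  have int_j: "integrable M (\<lambda>x. Y x $ j * V x $ j)" for j
  proof (rule Bochner_Integration.integrable_bound[OF int])
    show "(\<lambda>x. Y x $ j * V x $ j) \<in> borel_measurable M"
      by (intro borel_measurable_times nth YM V)
    show "AE x in M. norm (Y x $ j * V x $ j) \<le> norm (norm (Y x) * norm (V x))"
      by (auto simp: abs_mult intro!: mult_mono component_le_norm_cart)
  qed
  have "(\<integral>x. Y x $ j * V x $ j \<partial>M) = 0" for j
  proof -
    have "(\<integral>x. Y x $ j * V x $ j \<partial>M)
        = (\<integral>x. Y x $ j * real_cond_exp M F (\<lambda>x. V x $ j) x \<partial>M)"
      by (rule real_cond_exp_intg(2)[OF int_j nth[OF Y] nth[OF V], symmetric])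
    also have "\<dots> = (\<integral>x. 0 \<partial>M)"
    proof (rule integral_cong_AE)
      show "AE x in M. Y x $ j * real_cond_exp M F (\<lambda>x. V x $ j) x = 0"
        using centered by eventually_elim (simp add: vec_cond_exp_def vec_eq_iff)
    qed (intro borel_measurable_times nth YM borel_measurable_cond_exp2, simp)
    finally show ?thesis by simp
  qed
  with int_j show "integrable M (\<lambda>x. Y x \<bullet> V x)" "(\<integral>x. Y x \<bullet> V x \<partial>M) = 0"
    by (auto simp: inner_vec_def)
qed

end

context prob_space
begin

text \<open>
  Doob's maximal inequality for a nonnegative process that has the supermartingale
  property from time \<open>n\<close> on. Let \<open>D N\<close> be the event that level \<open>\<epsilon>\<close> has not been reached up
  to time \<open>N\<close>. Passing from \<open>N\<close> to \<open>N + 1\<close>, the paths in \<open>D N\<close> that cross the level take at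
  least \<open>\<epsilon>\<close> times their probability out of the remaining mass \<open>E (1\<^sub>D U)\<close>.
\<close>

lemma maximal_inequality:
  fixes U :: "nat \<Rightarrow> 'a \<Rightarrow> real"
  assumes sub: "\<And>i. subalgebra M (F i)" and mono: "\<And>i j. i \<le> j \<Longrightarrow> sets (F i) \<subseteq> sets (F j)"
    and U: "\<And>i. U i \<in> borel_measurable (F i)" "\<And>i. integrable M (U i)" "\<And>i x. 0 \<le> U i x"
    and super: "\<And>i D. n \<le> i \<Longrightarrow> D \<in> sets (F i) \<Longrightarrow>
        (\<integral>x. indicator D x * U (Suc i) x \<partial>M) \<le> (\<integral>x. indicator D x * U i x \<partial>M)"
    and "0 < \<epsilon>"
  shows "\<epsilon> * prob {x \<in> space M. \<exists>j\<ge>n. \<epsilon> \<le> U j x} \<le> expectation (U n)"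
proof -
  define D where "D N = {x \<in> space M. \<forall>j\<in>{n..N}. U j x < \<epsilon>}" for N
  have UM: "U i \<in> borel_measurable M" for i
    by (rule measurable_from_subalg[OF sub U(1)])
  have DF: "D N \<in> sets (F N)" for N
  proof -
    have "{x \<in> space (F N). U j x < \<epsilon>} \<in> sets (F N)" if "j \<le> N" for j
    proof -
      have sp: "space (F N) = space (F j)" using sub by (auto simp: subalgebra_def)
      have "{x \<in> space (F j). U j x < \<epsilon>} \<in> sets (F j)" using U(1)[of j] by measurable
      then show ?thesis using mono[OF that] unfolding sp by blast
    qed
    then have "{x \<in> space (F N). \<forall>j\<in>{n..N}. U j x < \<epsilon>} \<in> sets (F N)"
      by (intro sets.sets_Collect_finite_All) auto
    moreover have "space (F N) = space M" using sub by (auto simp: subalgebra_def)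
    ultimately show ?thesis by (simp add: D_def)
  qed
  have DM: "D N \<in> sets M" for N
    using DF sub by (auto simp: subalgebra_def)
  have int: "integrable M (\<lambda>x. indicator B x * U i x)" if "B \<in> sets M" for B i
    using integrable_mult_indicator[OF that U(2)] by simp
  have ind: "integrable M (\<lambda>x. \<epsilon> * indicator B x)"
      "\<epsilon> * prob B = (\<integral>x. \<epsilon> * indicator B x \<partial>M)" if "B \<in> sets M" for B
    using that sets.sets_into_space[OF that]
    by (auto intro!: integrable_mult_right integrable_real_indicator
        simp: emeasure_eq_measure Int_absorb2)
  have finite_horizon: "\<epsilon> * prob (space M - D N) + (\<integral>x. indicator (D N) x * U N x \<partial>M)
      \<le> expectation (U n)" if "n \<le> N" for N
    using that
  proof (induction N rule: dec_induct)
    case base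
    have "\<epsilon> * prob (space M - D n) = (\<integral>x. \<epsilon> * indicator (space M - D n) x \<partial>M)"
      using DM[of n] by (intro ind) auto
    also have "\<dots> + (\<integral>x. indicator (D n) x * U n x \<partial>M)
        = (\<integral>x. \<epsilon> * indicator (space M - D n) x + indicator (D n) x * U n x \<partial>M)"
      using DM[of n] by (intro Bochner_Integration.integral_add[symmetric] int ind) auto
    also have "\<dots> \<le> expectation (U n)"
      using DM[of n] U(2)[of n] U(3)
      by (intro integral_mono Bochner_Integration.integrable_add int ind)
        (auto simp: D_def indicator_def not_less)
    finally show ?case .
  next
    case (step N)
    have sub_D: "D (Suc N) \<subseteq> D N" by (auto simp: D_def)
    have "\<epsilon> * prob (D N - D (Suc N)) = (\<integral>x. \<epsilon> * indicator (D N - D (Suc N)) x \<partial>M)"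
      using DM by (intro ind) auto
    also have "\<dots> + (\<integral>x. indicator (D (Suc N)) x * U (Suc N) x \<partial>M)
        = (\<integral>x. \<epsilon> * indicator (D N - D (Suc N)) x + indicator (D (Suc N)) x * U (Suc N) x \<partial>M)"
      by (intro Bochner_Integration.integral_add[symmetric] int ind sets.Diff DM)
    also have "\<dots> \<le> (\<integral>x. indicator (D N) x * U (Suc N) x \<partial>M)"
    proof (intro integral_mono Bochner_Integration.integrable_add int DM)
      show "integrable M (\<lambda>x. \<epsilon> * indicator (D N - D (Suc N)) x)"
        by (intro ind sets.Diff DM)
      fix x assume "x \<in> space M"
      have "\<epsilon> \<le> U (Suc N) x" if "x \<in> D N" "x \<notin> D (Suc N)"
        using that step(1) by (auto simp: D_def not_less atLeastAtMostSuc_conv)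
      then show "\<epsilon> * indicator (D N - D (Suc N)) x + indicator (D (Suc N)) x * U (Suc N) x
          \<le> indicator (D N) x * U (Suc N) x"
        using sub_D U(3)[of "Suc N" x] by (auto simp: indicator_def)
    qed
    also have "\<dots> \<le> (\<integral>x. indicator (D N) x * U N x \<partial>M)"
      by (rule super[OF step(1) DF])
    finally have "\<epsilon> * prob (D N - D (Suc N)) + (\<integral>x. indicator (D (Suc N)) x * U (Suc N) x \<partial>M)
        \<le> (\<integral>x. indicator (D N) x * U N x \<partial>M)" .
    moreover have "prob (space M - D (Suc N)) = prob (space M - D N) + prob (D N - D (Suc N))"
      using DM sub_D by (simp add: prob_compl finite_measure_Diff)
    ultimately show ?case using step.IH by (simp add: distrib_left)
  qed
  have "incseq (\<lambda>N. space M - D N)" by (auto simp: incseq_def D_def)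
  moreover have "range (\<lambda>N. space M - D N) \<subseteq> sets M" using DM by auto
  ultimately have "(\<lambda>N. prob (space M - D N)) \<longlonglongrightarrow> prob (\<Union>N. space M - D N)"
    by (intro finite_Lim_measure_incseq)
  moreover have "(\<Union>N. space M - D N) = {x \<in> space M. \<exists>j\<ge>n. \<epsilon> \<le> U j x}"
    unfolding D_def by (auto simp: not_less) (meson atLeastAtMost_iff not_less order_refl)
  ultimately have lim: "(\<lambda>N. \<epsilon> * prob (space M - D N))
      \<longlonglongrightarrow> \<epsilon> * prob {x \<in> space M. \<exists>j\<ge>n. \<epsilon> \<le> U j x}"
    by (simp add: tendsto_mult_left)
  show ?thesis
  proof (rule LIMSEQ_le_const2[OF lim], intro exI allI impI)
    fix N assume "n \<le> N"
    moreover have "0 \<le> (\<integral>x. indicator (D N) x * U N x \<partial>M)"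
      using U(3) by (intro integral_nonneg_AE) auto
    ultimately show "\<epsilon> * prob (space M - D N) \<le> expectation (U n)"
      using finite_horizon[of N] by simp
  qed
qed

text \<open>
  By the maximal inequality, the probability of exceeding \<open>\<epsilon>\<close> at some time after \<open>n\<close>
  is at most \<open>E (U n) / \<epsilon>\<close>, and here the means vanish in the limit.
\<close>

lemma supermartingale_AE_tendsto_0:
  fixes U :: "nat \<Rightarrow> 'a \<Rightarrow> real"
  assumes sub: "\<And>i. subalgebra M (F i)" and mono: "\<And>i j. i \<le> j \<Longrightarrow> sets (F i) \<subseteq> sets (F j)"
    and U: "\<And>i. U i \<in> borel_measurable (F i)" "\<And>i. integrable M (U i)" "\<And>i x. 0 \<le> U i x"
    and super: "\<And>i D. N \<le> i \<Longrightarrow> D \<in> sets (F i) \<Longrightarrow>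
        (\<integral>x. indicator D x * U (Suc i) x \<partial>M) \<le> (\<integral>x. indicator D x * U i x \<partial>M)"
    and lim: "(\<lambda>i. expectation (U i)) \<longlonglongrightarrow> 0"
  shows "AE x in M. (\<lambda>i. U i x) \<longlonglongrightarrow> 0"
proof -
  have UM[measurable]: "U i \<in> borel_measurable M" for i
    by (rule measurable_from_subalg[OF sub U(1)])
  have "AE x in M. \<forall>\<^sub>F i in sequentially. U i x < \<epsilon>" if "0 < \<epsilon>" for \<epsilon>
  proof -
    define B where "B n = {x \<in> space M. \<exists>j\<ge>n. \<epsilon> \<le> U j x}" for n
    have BM[measurable]: "B n \<in> sets M" for n unfolding B_def by measurable
    have le: "prob (\<Inter>n. B n) \<le> expectation (U n) / \<epsilon>" if "N \<le> n" for n
    proof -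
      have "prob (\<Inter>n. B n) \<le> prob (B n)"
        by (intro finite_measure_mono) auto
      also have "\<epsilon> * prob (B n) \<le> expectation (U n)"
        unfolding B_def
        by (rule maximal_inequality[OF sub mono U]) (use super that \<open>0 < \<epsilon>\<close> in auto)
      then have "prob (B n) \<le> expectation (U n) / \<epsilon>"
        using \<open>0 < \<epsilon>\<close> by (simp add: field_simps)
      finally show ?thesis .
    qed
    have "(\<lambda>n. expectation (U n) / \<epsilon>) \<longlonglongrightarrow> 0"
      using tendsto_divide[OF lim tendsto_const, of \<epsilon>] \<open>0 < \<epsilon>\<close> by simp
    then have "prob (\<Inter>n. B n) \<le> 0"
      by (rule LIMSEQ_le_const) (use le in blast)
    then have "prob (\<Inter>n. B n) = 0" by (simp add: measure_le_0_iff)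
    then have "(\<Inter>n. B n) \<in> null_sets M"
      by (intro null_setsI) (auto simp: emeasure_eq_measure)
    then have "AE x in M. x \<notin> (\<Inter>n. B n)" by (rule AE_not_in)
    with AE_space show ?thesis
      by eventually_elim (simp add: B_def eventually_sequentially, meson not_less)
  qed
  then have "AE x in M. \<forall>m. \<forall>\<^sub>F i in sequentially. U i x < inverse (real (Suc m))"
    by (subst AE_all_countable) auto
  then show ?thesis
  proof eventually_elim
    case (elim x)
    show ?case
    proof (rule order_tendstoI)
      fix a :: real assume "a < 0"
      then show "\<forall>\<^sub>F i in sequentially. a < U i x"
        by (intro always_eventually allI) (rule less_le_trans[OF _ U(3)])
    next
      fix a :: real assume "0 < a"
      then obtain m where "inverse (real (Suc m)) < a" using reals_Archimedean by blast
      with elim[rule_format, of m] show "\<forall>\<^sub>F i in sequentially. U i x < a"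
        by (auto elim: eventually_mono)
    qed
  qed
qed

end

section \<open>Averaged recursions with centred noise\<close>

text \<open>
  The diffusion strategy seen from its errors: \<open>e i k\<close> is the error of agent \<open>k\<close> at time \<open>i\<close>,
  \<open>y i k\<close> its image under a noise-free gradient step, and \<open>v i k\<close> the gradient noise that
  enters between the times \<open>i\<close> and \<open>i + 1\<close>, which is why it is paired with the step size
  \<open>mu (Suc i)\<close> and conditioned on \<open>F i\<close>. The constants \<open>\<alpha>\<close> and \<open>s\<close> are parameters because
  the sharp rate has to hold for each admissible pair, not just for one.
\<close>

locale averaged_recursion = prob_space M for M :: "'w measure" +
  fixes F :: "nat \<Rightarrow> 'w measure" and A :: "real^'n::finite^'n" and mu :: "nat \<Rightarrow> real"
    and e y v :: "nat \<Rightarrow> 'n \<Rightarrow> 'w \<Rightarrow> real^'m::finite" and lam L \<alpha> s :: real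
  assumes sub: "\<And>i. subalgebra M (F i)"
    and F_mono: "\<And>i j. i \<le> j \<Longrightarrow> sets (F i) \<subseteq> sets (F j)"
    and e_meas: "\<And>i k. e i k \<in> borel_measurable (F i)"
    and y_meas: "\<And>i k. y i k \<in> borel_measurable (F i)"
    and v_meas: "\<And>i k. v i k \<in> borel_measurable M"
    and A_nonneg: "\<And>l k. 0 \<le> A $ l $ k"
    and A_sum: "\<And>k. (\<Sum>l\<in>UNIV. A $ l $ k) = 1"
    and recursion: "\<And>i k \<omega>. e (Suc i) k \<omega> = (\<Sum>l\<in>UNIV. A $ l $ k *\<^sub>R (y i l \<omega> + mu (Suc i) *\<^sub>R v i l \<omega>))"
    and drift: "\<And>i k \<omega>. (norm (y i k \<omega>))\<^sup>2
        \<le> (1 - 2 * lam * mu (Suc i) + L\<^sup>2 * (mu (Suc i))\<^sup>2) * (norm (e i k \<omega>))\<^sup>2"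
    and centered: "\<And>i k. AE \<omega> in M. vec_cond_exp M (F i) (v i k) \<omega> = 0"
    and second_moment: "\<And>i k. AE \<omega> in M. nn_cond_exp M (F i) (\<lambda>\<omega>. ennreal ((norm (v i k \<omega>))\<^sup>2)) \<omega>
        \<le> ennreal (\<alpha> * (norm (e i k \<omega>))\<^sup>2 + s)"
    and const: "0 \<le> \<alpha>" "0 \<le> s" "0 < lam" "lam \<le> L"
    and mu_pos: "\<And>i. 0 < mu (Suc i)"
    and init: "\<And>k. integrable M (\<lambda>\<omega>. (norm (e 0 k \<omega>))\<^sup>2)"
begin

lemma sigma_finite_F: "sigma_finite_subalgebra M (F i)"
  by (intro finite_measure_subalgebra_is_sigma_finite finite_measure_subalgebra.intro
      finite_measure_subalgebra_axioms.intro sub finite_measure_axioms)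

lemma e_measM [measurable]: "e i k \<in> borel_measurable M"
  by (rule measurable_from_subalg[OF sub e_meas])

lemma y_measM [measurable]: "y i k \<in> borel_measurable M"
  by (rule measurable_from_subalg[OF sub y_meas])

declare v_meas [measurable]

abbreviation contraction :: "nat \<Rightarrow> real" where
  "contraction i \<equiv> 1 - 2 * lam * mu (Suc i) + L\<^sup>2 * (mu (Suc i))\<^sup>2"

text \<open>
  Completing the square; this is where \<open>lam \<le> L\<close> enters. Thus bounds on moments may be
  multiplied by the contraction factor for large step sizes too.
\<close>

lemma contraction_nonneg: "0 \<le> contraction i"
proof -
  have "0 \<le> (1 - lam * mu (Suc i))\<^sup>2" by simp
  also have "\<dots> = 1 - 2 * lam * mu (Suc i) + lam\<^sup>2 * (mu (Suc i))\<^sup>2"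
    by (simp add: power2_eq_square algebra_simps)
  also have "\<dots> \<le> contraction i"
    using const by (intro add_left_mono mult_right_mono power_mono) auto
  finally show ?thesis .
qed

text \<open>
  The basic estimate of one adaptation step. The square expands into the drift part, a
  cross term of mean zero and the noise part. Integrating over an event \<open>D\<close> of the past
  expresses the conditional form of the estimate; the whole space yields the recursion of the
  moments.
\<close>

lemma step_set_integral:
  assumes e2: "integrable M (\<lambda>\<omega>. (norm (e i k \<omega>))\<^sup>2)" and D: "D \<in> sets (F i)"
  shows "integrable M (\<lambda>\<omega>. (norm (y i k \<omega> + mu (Suc i) *\<^sub>R v i k \<omega>))\<^sup>2)"
    and "(\<integral>\<omega>. indicator D \<omega> * (norm (y i k \<omega> + mu (Suc i) *\<^sub>R v i k \<omega>))\<^sup>2 \<partial>M)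
      \<le> (contraction i + \<alpha> * (mu (Suc i))\<^sup>2) * (\<integral>\<omega>. indicator D \<omega> * (norm (e i k \<omega>))\<^sup>2 \<partial>M)
        + (mu (Suc i))\<^sup>2 * s * prob D"
proof -
  interpret G: sigma_finite_subalgebra M "F i" by (rule sigma_finite_F)
  let ?m = "mu (Suc i)"
  have DM: "D \<in> events" using D sub by (auto simp: subalgebra_def)
  have int_ind: "integrable M (\<lambda>\<omega>. indicator D \<omega> * g \<omega>)" if "integrable M g" for g :: "'w \<Rightarrow> real"
    using integrable_mult_indicator[OF DM that] by simp
  have y2: "integrable M (\<lambda>\<omega>. (norm (y i k \<omega>))\<^sup>2)"
  proof (rule Bochner_Integration.integrable_bound)
    show "integrable M (\<lambda>\<omega>. contraction i * (norm (e i k \<omega>))\<^sup>2)" using e2 by simp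
    show "AE \<omega> in M. norm ((norm (y i k \<omega>))\<^sup>2) \<le> norm (contraction i * (norm (e i k \<omega>))\<^sup>2)"
      using drift by (intro AE_I2) (simp add: contraction_nonneg abs_mult)
  qed simp
  have v2: "integrable M (\<lambda>\<omega>. (norm (v i k \<omega>))\<^sup>2)"
    using G.integral_le_of_cond_bound(1)[of "\<lambda>_. 1" "\<lambda>\<omega>. (norm (v i k \<omega>))\<^sup>2"
        "\<lambda>\<omega>. \<alpha> * (norm (e i k \<omega>))\<^sup>2 + s"] second_moment[of i k] const e2 by simp
  have Dv2: "(\<integral>\<omega>. indicator D \<omega> * (norm (v i k \<omega>))\<^sup>2 \<partial>M)
      \<le> (\<integral>\<omega>. indicator D \<omega> * (\<alpha> * (norm (e i k \<omega>))\<^sup>2 + s) \<partial>M)"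
    by (rule G.integral_le_of_cond_bound(2))
      (use second_moment[of i k] const e2 D in \<open>auto intro!: int_ind\<close>)
  \<comment> \<open>square integrability makes the cross term integrable, hence its mean is zero\<close>
  have yv: "integrable M (\<lambda>\<omega>. norm (y i k \<omega>) * norm (v i k \<omega>))"
  proof (rule Bochner_Integration.integrable_bound)
    show "integrable M (\<lambda>\<omega>. (norm (y i k \<omega>))\<^sup>2 + (norm (v i k \<omega>))\<^sup>2)" using y2 v2 by simp
    show "AE \<omega> in M. norm (norm (y i k \<omega>) * norm (v i k \<omega>))
        \<le> norm ((norm (y i k \<omega>))\<^sup>2 + (norm (v i k \<omega>))\<^sup>2)"
    proof (intro AE_I2)
      fix \<omega>
      have "2 * norm (y i k \<omega>) * norm (v i k \<omega>) \<le> (norm (y i k \<omega>))\<^sup>2 + (norm (v i k \<omega>))\<^sup>2"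
        by (rule sum_squares_bound)
      moreover have "0 \<le> norm (y i k \<omega>) * norm (v i k \<omega>)" by simp
      ultimately show "norm (norm (y i k \<omega>) * norm (v i k \<omega>))
          \<le> norm ((norm (y i k \<omega>))\<^sup>2 + (norm (v i k \<omega>))\<^sup>2)"
        unfolding real_norm_def by linarith
    qed
  qed simp
  have Dy: "(\<lambda>\<omega>. indicator D \<omega> *\<^sub>R y i k \<omega>) \<in> borel_measurable (F i)"
    using D y_meas[of i k] by (intro borel_measurable_scaleR) auto
  have cross: "integrable M (\<lambda>\<omega>. (indicator D \<omega> *\<^sub>R y i k \<omega>) \<bullet> v i k \<omega>)"
      "(\<integral>\<omega>. (indicator D \<omega> *\<^sub>R y i k \<omega>) \<bullet> v i k \<omega> \<partial>M) = 0"
    using G.centered_inner_integral_zero[OF v_meas Dy centered] int_ind[OF yv]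
    by (simp_all add: mult.assoc)
  have yv': "integrable M (\<lambda>\<omega>. y i k \<omega> \<bullet> v i k \<omega>)"
    by (rule G.centered_inner_integral_zero(1)[OF v_meas y_meas centered yv])
  have expand: "(norm (y i k \<omega> + ?m *\<^sub>R v i k \<omega>))\<^sup>2
      = (norm (y i k \<omega>))\<^sup>2 + 2 * ?m * (y i k \<omega> \<bullet> v i k \<omega>) + ?m\<^sup>2 * (norm (v i k \<omega>))\<^sup>2" for \<omega>
    unfolding power2_norm_eq_inner
    by (simp add: inner_add_left inner_add_right inner_commute power2_eq_square algebra_simps)
  show "integrable M (\<lambda>\<omega>. (norm (y i k \<omega> + ?m *\<^sub>R v i k \<omega>))\<^sup>2)"
    unfolding expand using y2 v2 yv' by simp
  have "(\<integral>\<omega>. indicator D \<omega> * (norm (y i k \<omega> + ?m *\<^sub>R v i k \<omega>))\<^sup>2 \<partial>M)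
      = (\<integral>\<omega>. indicator D \<omega> * (norm (y i k \<omega>))\<^sup>2
          + 2 * ?m * ((indicator D \<omega> *\<^sub>R y i k \<omega>) \<bullet> v i k \<omega>)
          + ?m\<^sup>2 * (indicator D \<omega> * (norm (v i k \<omega>))\<^sup>2) \<partial>M)"
    unfolding expand by (intro Bochner_Integration.integral_cong) (auto simp: algebra_simps)
  also have "\<dots> = (\<integral>\<omega>. indicator D \<omega> * (norm (y i k \<omega>))\<^sup>2 \<partial>M)
      + ?m\<^sup>2 * (\<integral>\<omega>. indicator D \<omega> * (norm (v i k \<omega>))\<^sup>2 \<partial>M)"
    using int_ind[OF y2] int_ind[OF v2] cross
    by (simp add: Bochner_Integration.integral_add del: inner_scaleR_left)
  also have "\<dots> \<le> (\<integral>\<omega>. contraction i * (indicator D \<omega> * (norm (e i k \<omega>))\<^sup>2) \<partial>M)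
      + ?m\<^sup>2 * (\<integral>\<omega>. indicator D \<omega> * (\<alpha> * (norm (e i k \<omega>))\<^sup>2 + s) \<partial>M)"
  proof (intro add_mono mult_left_mono Dv2 integral_mono)
    show "indicator D \<omega> * (norm (y i k \<omega>))\<^sup>2 \<le> contraction i * (indicator D \<omega> * (norm (e i k \<omega>))\<^sup>2)" for \<omega>
      using drift[of i k \<omega>] by (simp add: indicator_def)
  qed (use int_ind[OF y2] int_ind[OF e2] in auto)
  also have "(\<integral>\<omega>. contraction i * (indicator D \<omega> * (norm (e i k \<omega>))\<^sup>2) \<partial>M)
      = contraction i * (\<integral>\<omega>. indicator D \<omega> * (norm (e i k \<omega>))\<^sup>2 \<partial>M)"
    by (rule integral_mult_right_zero)
  also have "(\<integral>\<omega>. indicator D \<omega> * (\<alpha> * (norm (e i k \<omega>))\<^sup>2 + s) \<partial>M)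
      = (\<integral>\<omega>. \<alpha> * (indicator D \<omega> * (norm (e i k \<omega>))\<^sup>2) + s * indicator D \<omega> \<partial>M)"
    by (intro Bochner_Integration.integral_cong) (auto simp: algebra_simps)
  also have "\<dots> = \<alpha> * (\<integral>\<omega>. indicator D \<omega> * (norm (e i k \<omega>))\<^sup>2 \<partial>M) + s * prob D"
    using int_ind[OF e2] int_ind[of "\<lambda>_. 1"] DM sets.sets_into_space[OF DM]
    by (simp add: Bochner_Integration.integral_add Int_absorb2)
  finally show "(\<integral>\<omega>. indicator D \<omega> * (norm (y i k \<omega> + ?m *\<^sub>R v i k \<omega>))\<^sup>2 \<partial>M)
      \<le> (contraction i + \<alpha> * ?m\<^sup>2) * (\<integral>\<omega>. indicator D \<omega> * (norm (e i k \<omega>))\<^sup>2 \<partial>M) + ?m\<^sup>2 * s * prob D"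
    by (simp add: algebra_simps)
qed

lemma norm_e_power_le:
  assumes "even r"
  shows "norm (e (Suc i) k \<omega>) ^ r \<le> (\<Sum>l\<in>UNIV. A $ l $ k * norm (y i l \<omega> + mu (Suc i) *\<^sub>R v i l \<omega>) ^ r)"
  unfolding recursion using A_nonneg A_sum assms by (intro convex_combination_norm_power) auto

lemma e_power_integrable:
  assumes "even r" and int: "\<And>l. integrable M (\<lambda>\<omega>. norm (y i l \<omega> + mu (Suc i) *\<^sub>R v i l \<omega>) ^ r)"
  shows "integrable M (\<lambda>\<omega>. norm (e (Suc i) k \<omega>) ^ r)"
proof (rule Bochner_Integration.integrable_bound)
  show "integrable M (\<lambda>\<omega>. \<Sum>l\<in>UNIV. A $ l $ k * norm (y i l \<omega> + mu (Suc i) *\<^sub>R v i l \<omega>) ^ r)"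
    using int by (intro Bochner_Integration.integrable_sum) auto
  show "AE \<omega> in M. norm (norm (e (Suc i) k \<omega>) ^ r)
      \<le> norm (\<Sum>l\<in>UNIV. A $ l $ k * norm (y i l \<omega> + mu (Suc i) *\<^sub>R v i l \<omega>) ^ r)"
    using norm_e_power_le[OF \<open>even r\<close>] by (intro AE_I2) (auto intro: order_trans[OF _ abs_ge_self])
qed simp

lemma e_square_integrable: "integrable M (\<lambda>\<omega>. (norm (e i k \<omega>))\<^sup>2)"
proof (induction i arbitrary: k)
  case 0
  show ?case by (rule init)
next
  case (Suc i)
  show ?case by (rule e_power_integrable[OF _ step_set_integral(1)[OF Suc.IH sets.top]]) simp
qed

lemma expectation_average_le:
  assumes "even r" and int: "\<And>l. integrable M (\<lambda>\<omega>. norm (y i l \<omega> + mu (Suc i) *\<^sub>R v i l \<omega>) ^ r)"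
    and bound: "\<And>l. expectation (\<lambda>\<omega>. norm (y i l \<omega> + mu (Suc i) *\<^sub>R v i l \<omega>) ^ r) \<le> B"
  shows "expectation (\<lambda>\<omega>. norm (e (Suc i) k \<omega>) ^ r) \<le> B"
proof -
  let ?g = "\<lambda>\<omega>. \<Sum>l\<in>UNIV. A $ l $ k * norm (y i l \<omega> + mu (Suc i) *\<^sub>R v i l \<omega>) ^ r"
  have "expectation (\<lambda>\<omega>. norm (e (Suc i) k \<omega>) ^ r) \<le> expectation ?g"
    using int by (intro integral_mono e_power_integrable norm_e_power_le \<open>even r\<close>
        Bochner_Integration.integrable_sum) auto
  also have "\<dots> = (\<Sum>l\<in>UNIV. A $ l $ k * expectation (\<lambda>\<omega>. norm (y i l \<omega> + mu (Suc i) *\<^sub>R v i l \<omega>) ^ r))"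
    using int by simp
  also have "\<dots> \<le> (\<Sum>l\<in>UNIV. A $ l $ k * B)"
    by (intro sum_mono mult_left_mono bound A_nonneg)
  also have "\<dots> = B" using A_sum[of k] by (simp flip: sum_distrib_right)
  finally show ?thesis .
qed

text \<open>
  The maximum over the agents loses nothing under averaging, and it bounds each agent
  with constant one; a Perron average would cost a factor \<open>1 / p\<^sub>k\<close>.
\<close>

definition worst_moment :: "nat \<Rightarrow> nat \<Rightarrow> real" where
  "worst_moment r i = Max (range (\<lambda>k. expectation (\<lambda>\<omega>. norm (e i k \<omega>) ^ r)))"

lemma expectation_le_worst_moment: "expectation (\<lambda>\<omega>. norm (e i k \<omega>) ^ r) \<le> worst_moment r i"
  unfolding worst_moment_def by (intro Max_ge) auto

lemma worst_moment_nonneg: "0 \<le> worst_moment r i"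
  by (rule order_trans[OF _ expectation_le_worst_moment[of i undefined r]]) (simp add: integral_nonneg_AE)

lemma worst_moment_leI: "(\<And>k. expectation (\<lambda>\<omega>. norm (e i k \<omega>) ^ r) \<le> B) \<Longrightarrow> worst_moment r i \<le> B"
  unfolding worst_moment_def by (subst Max_le_iff) auto

lemma worst_second_moment_step:
  "worst_moment 2 (Suc i) \<le> (contraction i + \<alpha> * (mu (Suc i))\<^sup>2) * worst_moment 2 i + (mu (Suc i))\<^sup>2 * s"
proof (rule worst_moment_leI, rule expectation_average_le)
  fix l
  show "integrable M (\<lambda>\<omega>. (norm (y i l \<omega> + mu (Suc i) *\<^sub>R v i l \<omega>))\<^sup>2)"
    by (rule step_set_integral(1)[OF e_square_integrable sets.top])
  have "(\<integral>\<omega>. (norm (y i l \<omega> + mu (Suc i) *\<^sub>R v i l \<omega>))\<^sup>2 \<partial>M)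
      = (\<integral>\<omega>. indicator (space M) \<omega> * (norm (y i l \<omega> + mu (Suc i) *\<^sub>R v i l \<omega>))\<^sup>2 \<partial>M)"
    by (intro Bochner_Integration.integral_cong) auto
  also have "\<dots> \<le> (contraction i + \<alpha> * (mu (Suc i))\<^sup>2)
        * (\<integral>\<omega>. indicator (space M) \<omega> * (norm (e i l \<omega>))\<^sup>2 \<partial>M) + (mu (Suc i))\<^sup>2 * s * prob (space M)"
    using sub[of i] by (intro step_set_integral(2)[OF e_square_integrable]) (metis sets.top subalgebra_def)
  also have "(\<integral>\<omega>. indicator (space M) \<omega> * (norm (e i l \<omega>))\<^sup>2 \<partial>M) = expectation (\<lambda>\<omega>. (norm (e i l \<omega>))\<^sup>2)"
    by (intro Bochner_Integration.integral_cong) auto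
  also have "(contraction i + \<alpha> * (mu (Suc i))\<^sup>2) * expectation (\<lambda>\<omega>. (norm (e i l \<omega>))\<^sup>2)
      \<le> (contraction i + \<alpha> * (mu (Suc i))\<^sup>2) * worst_moment 2 i"
    using contraction_nonneg[of i] const
    by (intro mult_left_mono expectation_le_worst_moment) auto
  finally show "expectation (\<lambda>\<omega>. (norm (y i l \<omega> + mu (Suc i) *\<^sub>R v i l \<omega>))\<^sup>2)
      \<le> (contraction i + \<alpha> * (mu (Suc i))\<^sup>2) * worst_moment 2 i + (mu (Suc i))\<^sup>2 * s"
    by (simp add: prob_space)
qed simp

text \<open>
  Once the step size is below \<open>lam / (L\<^sup>2 + \<alpha>)\<close>, half of the linear term absorbs the
  quadratic one, leaving the coefficient \<open>1 - lam \<mu>\<close>. The noise contributes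
  \<open>s \<mu>\<^sup>2 \<le> (lam \<mu>) \<epsilon>\<close> as soon as \<open>\<mu>\<close> is small relative to \<open>\<epsilon>\<close>.
\<close>

lemma worst_second_moment_tendsto_0:
  assumes mu_sum: "filterlim (\<lambda>n. \<Sum>i<n. mu (Suc i)) at_top sequentially" and mu_lim: "mu \<longlonglongrightarrow> 0"
  shows "worst_moment 2 \<longlonglongrightarrow> 0"
proof (rule LIMSEQ_I)
  fix r :: real assume "0 < r"
  define \<epsilon> where "\<epsilon> = r / 3"
  have \<epsilon>: "0 < \<epsilon>" "2 * \<epsilon> < r" using \<open>0 < r\<close> by (auto simp: \<epsilon>_def)
  define C where "C = L\<^sup>2 + \<alpha>"
  have C: "0 < C" using const by (simp add: C_def add_pos_nonneg)
  have mu_Suc: "(\<lambda>i. mu (Suc i)) \<longlonglongrightarrow> 0" using mu_lim by (rule LIMSEQ_Suc)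
  have small: "\<forall>\<^sub>F i in sequentially. mu (Suc i) < \<delta>" if "0 < \<delta>" for \<delta>
    using order_tendstoD(2)[OF mu_Suc that] .
  have "\<forall>\<^sub>F i in sequentially. worst_moment 2 i \<le> 2 * \<epsilon>"
  proof (rule contraction_eventually_le[where c = "\<lambda>i. lam * mu (Suc i)" and d = \<epsilon>])
    have "0 < lam / C" "0 < lam * \<epsilon> / (s + 1)"
      using const C \<epsilon> by auto
    then have "\<forall>\<^sub>F i in sequentially. mu (Suc i) < lam / C \<and> mu (Suc i) < lam * \<epsilon> / (s + 1)"
      by (intro eventually_conj small)
    then show "\<forall>\<^sub>F i in sequentially. worst_moment 2 (Suc i)
        \<le> (1 - lam * mu (Suc i)) * worst_moment 2 i + lam * mu (Suc i) * \<epsilon>"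
    proof eventually_elim
      case (elim i)
      have pos: "0 < mu (Suc i)" by (rule mu_pos)
      have "mu (Suc i) * C \<le> lam" using elim C by (simp add: field_simps)
      then have "mu (Suc i) * (mu (Suc i) * C) \<le> mu (Suc i) * lam" using pos by simp
      then have "contraction i + \<alpha> * (mu (Suc i))\<^sup>2 \<le> 1 - lam * mu (Suc i)"
        by (simp add: C_def power2_eq_square algebra_simps)
      then have "(contraction i + \<alpha> * (mu (Suc i))\<^sup>2) * worst_moment 2 i
          \<le> (1 - lam * mu (Suc i)) * worst_moment 2 i"
        by (intro mult_right_mono worst_moment_nonneg)
      moreover have "(mu (Suc i))\<^sup>2 * s \<le> lam * mu (Suc i) * \<epsilon>"
      proof -
        have "mu (Suc i) * (s + 1) \<le> lam * \<epsilon>"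
          using elim const by (simp add: field_simps)
        then have "mu (Suc i) * s \<le> lam * \<epsilon>" using pos by (simp add: algebra_simps)
        then have "mu (Suc i) * (mu (Suc i) * s) \<le> mu (Suc i) * (lam * \<epsilon>)"
          using pos by (intro mult_left_mono) auto
        then show ?thesis by (simp add: power2_eq_square mult_ac)
      qed
      ultimately show ?case using worst_second_moment_step[of i] by linarith
    qed
    show "\<forall>\<^sub>F i in sequentially. 0 \<le> lam * mu (Suc i) \<and> lam * mu (Suc i) \<le> 1"
    proof -
      have "0 < 1 / lam" using const by simp
      from small[OF this] show ?thesis
      proof eventually_elim
        case (elim i)
        then have "lam * mu (Suc i) \<le> 1" using const by (simp add: field_simps)
        moreover have "0 \<le> lam * mu (Suc i)" using const mu_pos[of i] by simp
        ultimately show ?case by simp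
      qed
    qed
    show "filterlim (\<lambda>n. \<Sum>i<n. lam * mu (Suc i)) at_top sequentially"
      unfolding sum_distrib_left[symmetric]
      by (rule filterlim_tendsto_pos_mult_at_top[OF tendsto_const const(3) mu_sum])
    show "\<epsilon> < 2 * \<epsilon>" using \<epsilon> by simp
  qed
  then obtain N where "\<And>i. i \<ge> N \<Longrightarrow> worst_moment 2 i \<le> 2 * \<epsilon>"
    by (auto simp: eventually_sequentially)
  then show "\<exists>no. \<forall>n\<ge>no. norm (worst_moment 2 n - 0) < r"
    using \<epsilon> worst_moment_nonneg[of 2] by (intro exI[of _ N]) (auto intro: le_less_trans)
qed

lemma worst_second_moment_rate:
  assumes mu: "\<And>i. mu (Suc i) = m / real (Suc i)" and "1 < 2 * lam * m"
    and "s * m\<^sup>2 / (2 * lam * m - 1) < K"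
  shows "\<forall>\<^sub>F i in sequentially. real i * worst_moment 2 i \<le> K"
proof -
  have "\<forall>\<^sub>F i in sequentially. real i ^ 1 * worst_moment 2 i \<le> K"
  proof (rule chung_rate[where a = "2 * lam * m" and C = "(L\<^sup>2 + \<alpha>) * m\<^sup>2" and b = "s * m\<^sup>2"])
    show "\<forall>\<^sub>F i in sequentially. worst_moment 2 (Suc i)
      \<le> (1 - 2 * lam * m / real (Suc i) + (L\<^sup>2 + \<alpha>) * m\<^sup>2 / real (Suc i) ^ 2) * worst_moment 2 i
        + s * m\<^sup>2 / real (Suc i) ^ Suc 1"
    proof (intro always_eventually allI)
      fix i
      have "contraction i + \<alpha> * (mu (Suc i))\<^sup>2
          = 1 - 2 * lam * m / real (Suc i) + (L\<^sup>2 + \<alpha>) * m\<^sup>2 / real (Suc i) ^ 2"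
        unfolding mu power_divide distrib_right add_divide_distrib by simp
      moreover have "(mu (Suc i))\<^sup>2 * s = s * m\<^sup>2 / real (Suc i) ^ Suc 1"
        unfolding mu power_divide numeral_2_eq_2 by simp
      ultimately show "worst_moment 2 (Suc i)
        \<le> (1 - 2 * lam * m / real (Suc i) + (L\<^sup>2 + \<alpha>) * m\<^sup>2 / real (Suc i) ^ 2) * worst_moment 2 i
          + s * m\<^sup>2 / real (Suc i) ^ Suc 1"
        using worst_second_moment_step[of i] by (simp only:)
    qed
  qed (use assms const worst_moment_nonneg in auto)
  then show ?thesis by simp
qed

text \<open>
  As \<open>A p = p\<close>, the \<open>p\<close>-weighted squared error \<open>S\<close> after averaging is at most the
  \<open>p\<close>-weighted square of the terms before averaging. When the step size is small its
  conditional mean therefore grows by at most \<open>s \<mu>\<^sup>2\<close> per step, and adding the remaining sum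
  \<open>T\<close> of these amounts makes it a supermartingale \<open>U\<close>. Positivity of \<open>p\<close> recovers each
  single error from \<open>S\<close>.
\<close>

lemma AE_tendsto_0:
  fixes p :: "real^'n"
  assumes perron: "A *v p = p" "\<And>k. 0 < p $ k" "(\<Sum>k\<in>UNIV. p $ k) = 1"
    and mu_sum: "filterlim (\<lambda>n. \<Sum>i<n. mu (Suc i)) at_top sequentially" and mu_lim: "mu \<longlonglongrightarrow> 0"
    and mu_sq: "summable (\<lambda>i. (mu i)\<^sup>2)"
  shows "AE \<omega> in M. \<forall>k. (\<lambda>i. e i k \<omega>) \<longlonglongrightarrow> 0"
proof -
  define S where "S i \<omega> = (\<Sum>k\<in>UNIV. p $ k * (norm (e i k \<omega>))\<^sup>2)" for i \<omega>
  define T where "T i = s * ((\<Sum>j. (mu (Suc j))\<^sup>2) - (\<Sum>j<i. (mu (Suc j))\<^sup>2))" for i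
  define U where "U i \<omega> = S i \<omega> + T i" for i \<omega>
  have mu_sq': "summable (\<lambda>i. (mu (Suc i))\<^sup>2)" using mu_sq by (subst summable_Suc_iff)
  have T_nonneg: "0 \<le> T i" for i
    unfolding T_def using const sum_le_suminf[OF mu_sq', of "{..<i}"] by simp
  have T_Suc: "T i = T (Suc i) + (mu (Suc i))\<^sup>2 * s" for i
    by (simp add: T_def algebra_simps)
  have T_lim: "T \<longlonglongrightarrow> 0"
  proof -
    have "T \<longlonglongrightarrow> s * ((\<Sum>j. (mu (Suc j))\<^sup>2) - (\<Sum>j. (mu (Suc j))\<^sup>2))"
      unfolding T_def by (intro tendsto_intros summable_LIMSEQ mu_sq')
    then show ?thesis by simp
  qed
  have S_nonneg: "0 \<le> S i \<omega>" for i \<omega>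
    unfolding S_def using perron(2) by (intro sum_nonneg mult_nonneg_nonneg) (auto intro: less_imp_le)
  have S_int: "integrable M (S i)" for i
    unfolding S_def using e_square_integrable by (intro Bochner_Integration.integrable_sum) auto
  have S_meas: "S i \<in> borel_measurable (F i)" for i
    unfolding S_def using e_meas by (intro borel_measurable_sum) auto
  have E_S: "expectation (S i) = (\<Sum>k\<in>UNIV. p $ k * expectation (\<lambda>\<omega>. (norm (e i k \<omega>))\<^sup>2))" for i
    unfolding S_def using e_square_integrable by (subst Bochner_Integration.integral_sum) auto
  have E_S_lim: "(\<lambda>i. expectation (S i)) \<longlonglongrightarrow> 0"
  proof (rule tendsto_sandwich[OF _ _ tendsto_const worst_second_moment_tendsto_0[OF mu_sum mu_lim]])
    show "\<forall>\<^sub>F i in sequentially. 0 \<le> expectation (S i)"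
      using S_nonneg by (intro always_eventually allI integral_nonneg_AE) auto
    have "expectation (S i) \<le> (\<Sum>k\<in>UNIV. p $ k * worst_moment 2 i)" for i
      unfolding E_S using perron(2)
      by (intro sum_mono mult_left_mono expectation_le_worst_moment) (auto intro: less_imp_le)
    also have "\<dots> i = worst_moment 2 i" for i
      using perron(3) by (simp flip: sum_distrib_right)
    finally show "\<forall>\<^sub>F i in sequentially. expectation (S i) \<le> worst_moment 2 i"
      by (intro always_eventually allI)
  qed
  have S_Suc: "S (Suc i) \<omega> \<le> (\<Sum>l\<in>UNIV. p $ l * (norm (y i l \<omega> + mu (Suc i) *\<^sub>R v i l \<omega>))\<^sup>2)" for i \<omega>
  proof -
    have "S (Suc i) \<omega> \<le> (\<Sum>k\<in>UNIV. p $ k *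
        (\<Sum>l\<in>UNIV. A $ l $ k * (norm (y i l \<omega> + mu (Suc i) *\<^sub>R v i l \<omega>))\<^sup>2))"
      unfolding S_def using perron(2)
      by (intro sum_mono mult_left_mono norm_e_power_le) (auto intro: less_imp_le)
    also have "\<dots> = (\<Sum>l\<in>UNIV. (\<Sum>k\<in>UNIV. A $ l $ k * p $ k) * (norm (y i l \<omega> + mu (Suc i) *\<^sub>R v i l \<omega>))\<^sup>2)"
      unfolding sum_distrib_left sum_distrib_right by (subst sum.swap) (simp add: mult_ac)
    also have "\<dots> = (\<Sum>l\<in>UNIV. p $ l * (norm (y i l \<omega> + mu (Suc i) *\<^sub>R v i l \<omega>))\<^sup>2)"
    proof -
      have "(\<Sum>k\<in>UNIV. A $ l $ k * p $ k) = p $ l" for l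
        using perron(1) by (simp add: vec_eq_iff matrix_vector_mult_def)
      then show ?thesis by simp
    qed
    finally show ?thesis .
  qed
  have mu_Suc: "(\<lambda>i. mu (Suc i)) \<longlonglongrightarrow> 0" using mu_lim by (rule LIMSEQ_Suc)
  have C: "0 < L\<^sup>2 + \<alpha>" using const by (simp add: add_pos_nonneg)
  then have "0 < 2 * lam / (L\<^sup>2 + \<alpha>)" using const by simp
  from order_tendstoD(2)[OF mu_Suc this] obtain N where
    N: "\<And>i. N \<le> i \<Longrightarrow> mu (Suc i) < 2 * lam / (L\<^sup>2 + \<alpha>)"
    by (auto simp: eventually_sequentially)
  have coeff: "contraction i + \<alpha> * (mu (Suc i))\<^sup>2 \<le> 1" if "N \<le> i" for i
  proof -
    have "mu (Suc i) * (L\<^sup>2 + \<alpha>) \<le> 2 * lam"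
      using N[OF that] unfolding pos_less_divide_eq[OF C] by simp
    then have "mu (Suc i) * (mu (Suc i) * (L\<^sup>2 + \<alpha>)) \<le> mu (Suc i) * (2 * lam)"
      using mu_pos[of i] by (intro mult_left_mono) auto
    then show ?thesis by (simp add: power2_eq_square algebra_simps)
  qed
  have "AE \<omega> in M. (\<lambda>i. U i \<omega>) \<longlonglongrightarrow> 0"
  proof (rule supermartingale_AE_tendsto_0[OF sub F_mono, where N = N])
    show "U i \<in> borel_measurable (F i)" for i unfolding U_def using S_meas by simp
    show "integrable M (U i)" for i unfolding U_def using S_int by simp
    show "0 \<le> U i \<omega>" for i \<omega> unfolding U_def using S_nonneg T_nonneg by simp
    have "(\<lambda>i. expectation (S i) + T i) \<longlonglongrightarrow> 0 + 0" by (intro tendsto_add E_S_lim T_lim)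
    then show "(\<lambda>i. expectation (U i)) \<longlonglongrightarrow> 0" unfolding U_def using S_int by (simp add: prob_space)
    fix i D assume "N \<le> i" and D: "D \<in> sets (F i)"
    have DM: "D \<in> events" using D sub by (auto simp: subalgebra_def)
    have int_ind: "integrable M (\<lambda>\<omega>. indicator D \<omega> * g \<omega>)" if "integrable M g" for g :: "'w \<Rightarrow> real"
      using integrable_mult_indicator[OF DM that] by simp
    note step = step_set_integral[OF e_square_integrable D]
    have split_U: "(\<integral>\<omega>. indicator D \<omega> * U j \<omega> \<partial>M) = (\<integral>\<omega>. indicator D \<omega> * S j \<omega> \<partial>M) + T j * prob D" for j
      unfolding U_def distrib_left using int_ind[OF S_int] int_ind[of "\<lambda>_. T j"] sets.sets_into_space[OF DM]
      by (subst Bochner_Integration.integral_add) (simp_all add: Int_absorb2)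
    have "(\<integral>\<omega>. indicator D \<omega> * S (Suc i) \<omega> \<partial>M)
        \<le> (\<integral>\<omega>. (\<Sum>l\<in>UNIV. p $ l * (indicator D \<omega> * (norm (y i l \<omega> + mu (Suc i) *\<^sub>R v i l \<omega>))\<^sup>2)) \<partial>M)"
    proof (rule integral_mono)
      show "integrable M (\<lambda>\<omega>. \<Sum>l\<in>UNIV. p $ l * (indicator D \<omega> * (norm (y i l \<omega> + mu (Suc i) *\<^sub>R v i l \<omega>))\<^sup>2))"
        using int_ind[OF step(1)] by (intro Bochner_Integration.integrable_sum) auto
      show "indicator D \<omega> * S (Suc i) \<omega>
          \<le> (\<Sum>l\<in>UNIV. p $ l * (indicator D \<omega> * (norm (y i l \<omega> + mu (Suc i) *\<^sub>R v i l \<omega>))\<^sup>2))" for \<omega>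
        using S_Suc[of i \<omega>] by (auto simp: indicator_def)
    qed (rule int_ind[OF S_int])
    also have "\<dots> = (\<Sum>l\<in>UNIV. p $ l * (\<integral>\<omega>. indicator D \<omega> * (norm (y i l \<omega> + mu (Suc i) *\<^sub>R v i l \<omega>))\<^sup>2 \<partial>M))"
      using int_ind[OF step(1)] by (subst Bochner_Integration.integral_sum) auto
    also have "\<dots> \<le> (\<Sum>l\<in>UNIV. p $ l * ((\<integral>\<omega>. indicator D \<omega> * (norm (e i l \<omega>))\<^sup>2 \<partial>M) + (mu (Suc i))\<^sup>2 * s * prob D))"
    proof (intro sum_mono mult_left_mono)
      fix l
      have "0 \<le> (\<integral>\<omega>. indicator D \<omega> * (norm (e i l \<omega>))\<^sup>2 \<partial>M)" by (intro integral_nonneg_AE) auto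
      from mult_right_mono[OF coeff[OF \<open>N \<le> i\<close>] this] step(2)[of l]
      show "(\<integral>\<omega>. indicator D \<omega> * (norm (y i l \<omega> + mu (Suc i) *\<^sub>R v i l \<omega>))\<^sup>2 \<partial>M)
          \<le> (\<integral>\<omega>. indicator D \<omega> * (norm (e i l \<omega>))\<^sup>2 \<partial>M) + (mu (Suc i))\<^sup>2 * s * prob D" by linarith
      show "0 \<le> p $ l" using perron(2) by (rule less_imp_le)
    qed
    also have "\<dots> = (\<Sum>l\<in>UNIV. p $ l * (\<integral>\<omega>. indicator D \<omega> * (norm (e i l \<omega>))\<^sup>2 \<partial>M)) + (mu (Suc i))\<^sup>2 * s * prob D"
      unfolding distrib_left sum.distrib sum_distrib_right[symmetric] perron(3) by simp
    also have "(\<Sum>l\<in>UNIV. p $ l * (\<integral>\<omega>. indicator D \<omega> * (norm (e i l \<omega>))\<^sup>2 \<partial>M)) = (\<integral>\<omega>. indicator D \<omega> * S i \<omega> \<partial>M)"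
    proof -
      have "(\<lambda>\<omega>. indicator D \<omega> * S i \<omega>) = (\<lambda>\<omega>. \<Sum>l\<in>UNIV. p $ l * (indicator D \<omega> * (norm (e i l \<omega>))\<^sup>2))"
        by (simp add: S_def sum_distrib_left mult_ac)
      then show ?thesis
        using int_ind[OF e_square_integrable] by (simp only:) (subst Bochner_Integration.integral_sum, auto)
    qed
    finally show "(\<integral>\<omega>. indicator D \<omega> * U (Suc i) \<omega> \<partial>M) \<le> (\<integral>\<omega>. indicator D \<omega> * U i \<omega> \<partial>M)"
      unfolding split_U T_Suc[of i] by (simp add: algebra_simps)
  qed
  then show ?thesis
  proof eventually_elim
    case (elim \<omega>)
    show ?case
    proof
      fix k
      have "(\<lambda>i. U i \<omega> / p $ k) \<longlonglongrightarrow> 0 / p $ k"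
        using perron(2)[of k] by (intro tendsto_divide elim tendsto_const) auto
      then have lim: "(\<lambda>i. U i \<omega> / p $ k) \<longlonglongrightarrow> 0" by simp
      have bound: "norm ((norm (e i k \<omega>))\<^sup>2) \<le> U i \<omega> / p $ k" for i
      proof -
        have "p $ k * (norm (e i k \<omega>))\<^sup>2 \<le> S i \<omega>"
          unfolding S_def using perron(2)
          by (intro member_le_sum[where f = "\<lambda>k. p $ k * (norm (e i k \<omega>))\<^sup>2"])
            (auto intro!: mult_nonneg_nonneg intro: less_imp_le)
        then show ?thesis
          using T_nonneg[of i] perron(2)[of k] by (simp add: U_def field_simps)
      qed
      have "(\<lambda>i. (norm (e i k \<omega>))\<^sup>2) \<longlonglongrightarrow> 0"
        by (rule Lim_null_comparison[OF always_eventually lim]) (intro allI bound)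
      then have "(\<lambda>i. sqrt ((norm (e i k \<omega>))\<^sup>2)) \<longlonglongrightarrow> sqrt 0" by (intro tendsto_real_sqrt)
      then show "(\<lambda>i. e i k \<omega>) \<longlonglongrightarrow> 0" by (simp add: tendsto_norm_zero_iff)
    qed
  qed
qed

text \<open>
  The linear term of \<open>norm_add_power4_le\<close> vanishes in the mean since \<open>\<parallel>y\<parallel>\<^sup>2 y\<close> is
  known from the past. In the mixed term \<open>\<parallel>y\<parallel>\<^sup>2 \<parallel>v\<parallel>\<^sup>2\<close> only the conditional second moment
  of the noise occurs, so its constant part \<open>s\<close> is multiplied by a second moment of the error
  and not by a fourth one.
\<close>

lemma fourth_moment_step:
  assumes fourth: "\<And>i k. AE \<omega> in M. nn_cond_exp M (F i) (\<lambda>\<omega>. ennreal (norm (v i k \<omega>) ^ 4)) \<omega>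
        \<le> ennreal (\<alpha>4 * norm (e i k \<omega>) ^ 4 + s4)"
    and const4: "0 \<le> \<alpha>4" "0 \<le> s4"
    and e4: "integrable M (\<lambda>\<omega>. norm (e i k \<omega>) ^ 4)"
  shows "integrable M (\<lambda>\<omega>. norm (y i k \<omega> + mu (Suc i) *\<^sub>R v i k \<omega>) ^ 4)"
    and "expectation (\<lambda>\<omega>. norm (y i k \<omega> + mu (Suc i) *\<^sub>R v i k \<omega>) ^ 4)
      \<le> ((contraction i)\<^sup>2 + 8 * (mu (Suc i))\<^sup>2 * contraction i * \<alpha> + 3 * mu (Suc i) ^ 4 * \<alpha>4)
            * expectation (\<lambda>\<omega>. norm (e i k \<omega>) ^ 4)
        + 8 * (mu (Suc i))\<^sup>2 * contraction i * s * expectation (\<lambda>\<omega>. (norm (e i k \<omega>))\<^sup>2)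
        + 3 * mu (Suc i) ^ 4 * s4"
proof -
  interpret G: sigma_finite_subalgebra M "F i" by (rule sigma_finite_F)
  let ?m = "mu (Suc i)" and ?c = "contraction i"
  define a b g where "a \<omega> = (norm (e i k \<omega>))\<^sup>2" and "b \<omega> = (norm (y i k \<omega>))\<^sup>2"
    and "g \<omega> = (norm (v i k \<omega>))\<^sup>2" for \<omega>
  have pow4: "norm z ^ 4 = ((norm z)\<^sup>2)\<^sup>2" for z :: "real^'m" by simp
  have pos: "0 \<le> a \<omega>" "0 \<le> b \<omega>" "0 \<le> g \<omega>" for \<omega> by (auto simp: a_def b_def g_def)
  have meas: "a \<in> borel_measurable (F i)" "b \<in> borel_measurable (F i)" "g \<in> borel_measurable M"
    unfolding a_def b_def g_def using e_meas[of i k] y_meas[of i k] by auto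
  have measM [measurable]: "a \<in> borel_measurable M" "b \<in> borel_measurable M" "g \<in> borel_measurable M"
    unfolding a_def b_def g_def by auto
  have a2: "integrable M (\<lambda>\<omega>. (a \<omega>)\<^sup>2)" using e4 by (simp only: a_def pow4)
  have a1: "integrable M a" unfolding a_def by (rule e_square_integrable)
  have ba: "b \<omega> \<le> ?c * a \<omega>" for \<omega> unfolding a_def b_def by (rule drift)
  have b2a: "(b \<omega>)\<^sup>2 \<le> ?c\<^sup>2 * (a \<omega>)\<^sup>2" for \<omega>
    using power_mono[OF ba pos(2), of \<omega> 2] by (simp add: power_mult_distrib)
  have b2: "integrable M (\<lambda>\<omega>. (b \<omega>)\<^sup>2)"
  proof (rule Bochner_Integration.integrable_bound)
    show "integrable M (\<lambda>\<omega>. ?c\<^sup>2 * (a \<omega>)\<^sup>2)" using a2 by simp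
    show "AE \<omega> in M. norm ((b \<omega>)\<^sup>2) \<le> norm (?c\<^sup>2 * (a \<omega>)\<^sup>2)" using b2a by (intro AE_I2) simp
  qed simp
  have b2_le: "expectation (\<lambda>\<omega>. (b \<omega>)\<^sup>2) \<le> ?c\<^sup>2 * expectation (\<lambda>\<omega>. (a \<omega>)\<^sup>2)"
    unfolding integral_mult_right_zero[symmetric] using a2 b2 b2a by (intro integral_mono) auto
  have fourth': "AE \<omega> in M. nn_cond_exp M (F i) (\<lambda>\<omega>. ennreal ((g \<omega>)\<^sup>2)) \<omega> \<le> ennreal (\<alpha>4 * (a \<omega>)\<^sup>2 + s4)"
    using fourth[of i k] by (simp only: pow4 a_def g_def)
  have g2: "integrable M (\<lambda>\<omega>. (g \<omega>)\<^sup>2)"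
      "expectation (\<lambda>\<omega>. (g \<omega>)\<^sup>2) \<le> \<alpha>4 * expectation (\<lambda>\<omega>. (a \<omega>)\<^sup>2) + s4"
    using G.integral_le_of_cond_bound[of "\<lambda>_. 1" "\<lambda>\<omega>. (g \<omega>)\<^sup>2" "\<lambda>\<omega>. \<alpha>4 * (a \<omega>)\<^sup>2 + s4"] fourth' const4 a2
    by (simp_all add: prob_space)
  have second': "AE \<omega> in M. nn_cond_exp M (F i) (\<lambda>\<omega>. ennreal (g \<omega>)) \<omega> \<le> ennreal (\<alpha> * a \<omega> + s)"
    using second_moment[of i k] by (simp only: a_def g_def)
  have b_bound: "b \<omega> * (\<alpha> * a \<omega> + s) \<le> ?c * \<alpha> * (a \<omega>)\<^sup>2 + ?c * s * a \<omega>" for \<omega>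
  proof -
    have "b \<omega> * (\<alpha> * a \<omega> + s) \<le> ?c * a \<omega> * (\<alpha> * a \<omega> + s)"
      using const pos by (intro mult_right_mono ba) auto
    moreover have "q * u * (\<alpha> * u + s) = q * \<alpha> * u\<^sup>2 + q * s * u" for q u :: real
      by (simp add: power2_eq_square algebra_simps)
    ultimately show ?thesis by (simp only:)
  qed
  have b_int: "integrable M (\<lambda>\<omega>. b \<omega> * (\<alpha> * a \<omega> + s))"
  proof (rule Bochner_Integration.integrable_bound)
    show "integrable M (\<lambda>\<omega>. ?c * \<alpha> * (a \<omega>)\<^sup>2 + ?c * s * a \<omega>)" using a1 a2 by simp
    show "AE \<omega> in M. norm (b \<omega> * (\<alpha> * a \<omega> + s)) \<le> norm (?c * \<alpha> * (a \<omega>)\<^sup>2 + ?c * s * a \<omega>)"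
    proof (intro AE_I2)
      fix \<omega>
      have "0 \<le> b \<omega> * (\<alpha> * a \<omega> + s)" using const pos by simp
      then show "norm (b \<omega> * (\<alpha> * a \<omega> + s)) \<le> norm (?c * \<alpha> * (a \<omega>)\<^sup>2 + ?c * s * a \<omega>)"
        using b_bound[of \<omega>] unfolding real_norm_def by linarith
    qed
  qed simp
  have bg: "integrable M (\<lambda>\<omega>. b \<omega> * g \<omega>)"
      "expectation (\<lambda>\<omega>. b \<omega> * g \<omega>) \<le> expectation (\<lambda>\<omega>. b \<omega> * (\<alpha> * a \<omega> + s))"
    using G.integral_le_of_cond_bound[OF meas(2) measM(3) pos(2) pos(3) _ second' b_int] const pos
    by auto
  have bg_le: "expectation (\<lambda>\<omega>. b \<omega> * g \<omega>)
      \<le> ?c * \<alpha> * expectation (\<lambda>\<omega>. (a \<omega>)\<^sup>2) + ?c * s * expectation a"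
  proof -
    have "expectation (\<lambda>\<omega>. b \<omega> * (\<alpha> * a \<omega> + s)) \<le> expectation (\<lambda>\<omega>. ?c * \<alpha> * (a \<omega>)\<^sup>2 + ?c * s * a \<omega>)"
      using a1 a2 by (intro integral_mono b_int b_bound) auto
    also have "\<dots> = ?c * \<alpha> * expectation (\<lambda>\<omega>. (a \<omega>)\<^sup>2) + ?c * s * expectation a"
      using a1 a2 by simp
    finally show ?thesis using bg(2) by linarith
  qed
  have int_cross: "integrable M (\<lambda>\<omega>. norm (b \<omega> *\<^sub>R y i k \<omega>) * norm (v i k \<omega>))"
  proof (rule Bochner_Integration.integrable_bound)
    show "integrable M (\<lambda>\<omega>. (b \<omega>)\<^sup>2 + b \<omega> * g \<omega>)" using b2 bg(1) by simp
    show "AE \<omega> in M. norm (norm (b \<omega> *\<^sub>R y i k \<omega>) * norm (v i k \<omega>)) \<le> norm ((b \<omega>)\<^sup>2 + b \<omega> * g \<omega>)"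
    proof (intro AE_I2)
      fix \<omega>
      have "2 * norm (y i k \<omega>) * norm (v i k \<omega>) \<le> b \<omega> + g \<omega>"
        unfolding b_def g_def by (rule sum_squares_bound)
      moreover have "0 \<le> norm (y i k \<omega>) * norm (v i k \<omega>)" by simp
      ultimately have "norm (y i k \<omega>) * norm (v i k \<omega>) \<le> b \<omega> + g \<omega>" by linarith
      then have "b \<omega> * (norm (y i k \<omega>) * norm (v i k \<omega>)) \<le> b \<omega> * (b \<omega> + g \<omega>)"
        using pos by (intro mult_left_mono) auto
      then show "norm (norm (b \<omega> *\<^sub>R y i k \<omega>) * norm (v i k \<omega>)) \<le> norm ((b \<omega>)\<^sup>2 + b \<omega> * g \<omega>)"
        using pos by (simp add: power2_eq_square distrib_left mult.assoc)
    qed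
  qed simp
  have by_meas: "(\<lambda>\<omega>. b \<omega> *\<^sub>R y i k \<omega>) \<in> borel_measurable (F i)"
    by (intro borel_measurable_scaleR meas y_meas)
  note cross = G.centered_inner_integral_zero[OF v_meas by_meas centered int_cross]
  let ?h = "\<lambda>\<omega>. (b \<omega>)\<^sup>2 + 4 * ?m * ((b \<omega> *\<^sub>R y i k \<omega>) \<bullet> v i k \<omega>)
      + 8 * ?m\<^sup>2 * (b \<omega> * g \<omega>) + 3 * ?m ^ 4 * (g \<omega>)\<^sup>2"
  have h: "integrable M ?h" using b2 cross(1) bg(1) g2(1)
    by (intro Bochner_Integration.integrable_add integrable_mult_right)
  have le_h: "norm (y i k \<omega> + ?m *\<^sub>R v i k \<omega>) ^ 4 \<le> ?h \<omega>" for \<omega>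
  proof -
    have "norm (?m *\<^sub>R v i k \<omega>) = ?m * norm (v i k \<omega>)" using mu_pos[of i] by simp
    then have "norm (y i k \<omega> + ?m *\<^sub>R v i k \<omega>) ^ 4
        \<le> norm (y i k \<omega>) ^ 4 + 4 * b \<omega> * (?m * (y i k \<omega> \<bullet> v i k \<omega>))
          + 8 * b \<omega> * (?m\<^sup>2 * g \<omega>) + 3 * (?m ^ 4 * norm (v i k \<omega>) ^ 4)"
      using norm_add_power4_le[of "y i k \<omega>" "?m *\<^sub>R v i k \<omega>"]
      by (simp only: b_def g_def power_mult_distrib inner_scaleR_right)
    moreover have "norm (y i k \<omega>) ^ 4 = (b \<omega>)\<^sup>2" "norm (v i k \<omega>) ^ 4 = (g \<omega>)\<^sup>2"
      by (simp_all add: b_def g_def)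
    ultimately show ?thesis by (simp only: inner_scaleR_left mult.assoc mult.left_commute)
  qed
  show i4: "integrable M (\<lambda>\<omega>. norm (y i k \<omega> + ?m *\<^sub>R v i k \<omega>) ^ 4)"
  proof (rule Bochner_Integration.integrable_bound[OF h])
    show "AE \<omega> in M. norm (norm (y i k \<omega> + ?m *\<^sub>R v i k \<omega>) ^ 4) \<le> norm (?h \<omega>)"
    proof (intro AE_I2)
      fix \<omega>
      have "0 \<le> norm (y i k \<omega> + ?m *\<^sub>R v i k \<omega>) ^ 4" by simp
      then show "norm (norm (y i k \<omega> + ?m *\<^sub>R v i k \<omega>) ^ 4) \<le> norm (?h \<omega>)"
        using le_h[of \<omega>] unfolding real_norm_def by linarith
    qed
  qed simp
  have collect: "q\<^sup>2 * X + 8 * t\<^sup>2 * (q * \<alpha> * X + q * s * Y) + 3 * t ^ 4 * (\<alpha>4 * X + s4)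
      = (q\<^sup>2 + 8 * t\<^sup>2 * q * \<alpha> + 3 * t ^ 4 * \<alpha>4) * X + 8 * t\<^sup>2 * q * s * Y + 3 * t ^ 4 * s4"
    for q t X Y :: real
    by (simp add: algebra_simps)
  have "expectation (\<lambda>\<omega>. norm (y i k \<omega> + ?m *\<^sub>R v i k \<omega>) ^ 4) \<le> expectation ?h"
    by (intro integral_mono i4 h le_h)
  also have "\<dots> = expectation (\<lambda>\<omega>. (b \<omega>)\<^sup>2) + 8 * ?m\<^sup>2 * expectation (\<lambda>\<omega>. b \<omega> * g \<omega>)
      + 3 * ?m ^ 4 * expectation (\<lambda>\<omega>. (g \<omega>)\<^sup>2)"
    using b2 cross bg(1) g2(1) by (simp del: inner_scaleR_left)
  also have "\<dots> \<le> ?c\<^sup>2 * expectation (\<lambda>\<omega>. (a \<omega>)\<^sup>2)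
      + 8 * ?m\<^sup>2 * (?c * \<alpha> * expectation (\<lambda>\<omega>. (a \<omega>)\<^sup>2) + ?c * s * expectation a)
      + 3 * ?m ^ 4 * (\<alpha>4 * expectation (\<lambda>\<omega>. (a \<omega>)\<^sup>2) + s4)"
    by (intro add_mono mult_left_mono b2_le bg_le g2(2)) auto
  also have "\<dots> = (?c\<^sup>2 + 8 * ?m\<^sup>2 * ?c * \<alpha> + 3 * ?m ^ 4 * \<alpha>4) * expectation (\<lambda>\<omega>. (a \<omega>)\<^sup>2)
      + 8 * ?m\<^sup>2 * ?c * s * expectation a + 3 * ?m ^ 4 * s4"
    by (rule collect)
  finally show "expectation (\<lambda>\<omega>. norm (y i k \<omega> + ?m *\<^sub>R v i k \<omega>) ^ 4)
      \<le> (?c\<^sup>2 + 8 * ?m\<^sup>2 * ?c * \<alpha> + 3 * ?m ^ 4 * \<alpha>4) * expectation (\<lambda>\<omega>. norm (e i k \<omega>) ^ 4)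
        + 8 * ?m\<^sup>2 * ?c * s * expectation (\<lambda>\<omega>. (norm (e i k \<omega>))\<^sup>2) + 3 * ?m ^ 4 * s4"
    unfolding a_def by (simp only: pow4)
qed

text \<open>
  With \<open>\<mu> = m/i\<close> the squared contraction factor is \<open>1 - 4 lam m/i + O(1/i\<^sup>2)\<close>, and
  \<open>4 lam m > 2\<close> is what Chung's lemma needs for the exponent \<open>r = 2\<close>. The inhomogeneity
  is of the required order \<open>1/i\<^sup>3\<close> because the second moments are \<open>O(1/i)\<close>.
\<close>

lemma fourth_moment_rate:
  assumes fourth: "\<And>i k. AE \<omega> in M. nn_cond_exp M (F i) (\<lambda>\<omega>. ennreal (norm (v i k \<omega>) ^ 4)) \<omega>
        \<le> ennreal (\<alpha>4 * norm (e i k \<omega>) ^ 4 + s4)"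
    and const4: "0 \<le> \<alpha>4" "0 \<le> s4"
    and init4: "\<And>k. integrable M (\<lambda>\<omega>. norm (e 0 k \<omega>) ^ 4)"
    and mu: "\<And>i. mu (Suc i) = m / real (Suc i)" and m: "1 < 2 * lam * m"
  shows "integrable M (\<lambda>\<omega>. norm (e i k \<omega>) ^ 4)"
    and "\<exists>K. \<forall>\<^sub>F i in sequentially. (real i)\<^sup>2 * worst_moment 4 i \<le> K"
proof -
  note step = fourth_moment_step[OF fourth const4]
  show int4: "integrable M (\<lambda>\<omega>. norm (e i k \<omega>) ^ 4)" for i k
  proof (induction i arbitrary: k)
    case 0
    show ?case by (rule init4)
  next
    case (Suc i)
    show ?case by (rule e_power_integrable[OF _ step(1)[OF Suc.IH]]) simp
  qed
  define E2 where "E2 = s * m\<^sup>2 / (2 * lam * m - 1) + 1"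
  have E2_rate: "\<forall>\<^sub>F i in sequentially. real i * worst_moment 2 i \<le> E2"
    by (rule worst_second_moment_rate[OF mu m]) (simp add: E2_def)
  have E2_nonneg: "0 \<le> E2" using const m by (simp add: E2_def add_nonneg_pos less_imp_le)
  have m_pos: "0 < m" using mu_pos[of 0] mu[of 0] by simp
  \<comment> \<open>all step sizes are at most \<open>m\<close>, so \<open>c\<close> bounds the contraction factors and the
      terms of order \<open>\<mu>\<^sup>3\<close> and higher can be absorbed into \<open>C \<mu>\<^sup>2\<close>\<close>
  define c where "c = 1 + L\<^sup>2 * m\<^sup>2"
  define C where "C = 4 * lam\<^sup>2 + 2 * L\<^sup>2 + L ^ 4 * m\<^sup>2 + 8 * c * \<alpha> + 3 * m\<^sup>2 * \<alpha>4"
  define B where "B = 16 * m\<^sup>2 * c * s * E2 + 3 * m ^ 4 * s4"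
  have c_pos: "0 < c" by (simp add: c_def add_pos_nonneg)
  have mu_le: "mu (Suc i) \<le> m" "0 \<le> mu (Suc i)" for i
    using m_pos mu_pos[of i] unfolding mu by (auto simp: field_simps)
  have c_le: "contraction i \<le> c" for i
  proof -
    have "L\<^sup>2 * (mu (Suc i))\<^sup>2 \<le> L\<^sup>2 * m\<^sup>2" using mu_le by (intro mult_left_mono power_mono) auto
    moreover have "0 \<le> lam * mu (Suc i)" using const mu_le by simp
    ultimately show ?thesis by (simp add: c_def)
  qed
  have coeff: "(contraction i)\<^sup>2 + 8 * (mu (Suc i))\<^sup>2 * contraction i * \<alpha> + 3 * mu (Suc i) ^ 4 * \<alpha>4
      \<le> 1 - 4 * lam * mu (Suc i) + C * (mu (Suc i))\<^sup>2" for i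
  proof -
    define t where "t = mu (Suc i)"
    have t: "0 \<le> t" "t \<le> m" using mu_le[of i] by (auto simp: t_def)
    have t2: "t\<^sup>2 \<le> m\<^sup>2" using t by (intro power_mono)
    have "(contraction i)\<^sup>2 = 1 - 4 * lam * t + (4 * lam\<^sup>2 + 2 * L\<^sup>2) * t\<^sup>2 + L ^ 4 * t\<^sup>2 * t\<^sup>2 - 4 * lam * L\<^sup>2 * t ^ 3"
      unfolding t_def[symmetric] by (simp add: power2_eq_square power3_eq_cube power4_eq_xxxx algebra_simps)
    moreover have "L ^ 4 * t\<^sup>2 * t\<^sup>2 \<le> L ^ 4 * m\<^sup>2 * t\<^sup>2" using t2 by (intro mult_right_mono mult_left_mono) auto
    moreover have "0 \<le> 4 * lam * L\<^sup>2 * t ^ 3" using const t by simp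
    moreover have "8 * t\<^sup>2 * contraction i * \<alpha> \<le> 8 * t\<^sup>2 * c * \<alpha>"
      using const c_le[of i] by (intro mult_right_mono mult_left_mono) auto
    moreover have "3 * t ^ 4 * \<alpha>4 \<le> 3 * (m\<^sup>2 * t\<^sup>2) * \<alpha>4"
    proof -
      have "t ^ 4 = t\<^sup>2 * t\<^sup>2" by (simp add: power2_eq_square power4_eq_xxxx)
      then show ?thesis using const4 t2 by (simp only:) (intro mult_right_mono mult_left_mono, auto)
    qed
    ultimately show ?thesis unfolding C_def t_def[symmetric] by (simp add: algebra_simps)
  qed
  have rec: "\<forall>\<^sub>F i in sequentially. worst_moment 4 (Suc i)
      \<le> (1 - 4 * lam * m / real (Suc i) + C * m\<^sup>2 / real (Suc i) ^ 2) * worst_moment 4 i + B / real (Suc i) ^ Suc 2"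
    using E2_rate eventually_ge_at_top[of 1]
  proof eventually_elim
    case (elim i)
    define t where "t = mu (Suc i)"
    have t: "0 \<le> t" using mu_le[of i] by (simp add: t_def)
    \<comment> \<open>the factor \<open>2\<close> pays for the shift of the index: \<open>i + 1 \<le> 2 i\<close>\<close>
    have E2_Suc: "worst_moment 2 i \<le> 2 * E2 / real (Suc i)"
    proof -
      have "real (Suc i) * worst_moment 2 i \<le> (2 * real i) * worst_moment 2 i"
        using elim by (intro mult_right_mono worst_moment_nonneg) auto
      also have "\<dots> \<le> 2 * E2" using elim by simp
      finally show ?thesis by (simp add: field_simps)
    qed
    have main: "worst_moment 4 (Suc i) \<le> (1 - 4 * lam * t + C * t\<^sup>2) * worst_moment 4 i
        + 8 * t\<^sup>2 * c * s * (2 * E2 / real (Suc i)) + 3 * t ^ 4 * s4"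
    proof (rule worst_moment_leI, rule expectation_average_le[OF _ step(1)[OF int4]])
      fix l
      have cf: "0 \<le> (contraction i)\<^sup>2 + 8 * t\<^sup>2 * contraction i * \<alpha> + 3 * t ^ 4 * \<alpha>4"
      proof -
        have "0 \<le> q\<^sup>2 + 8 * t\<^sup>2 * q * \<alpha> + 3 * t ^ 4 * \<alpha>4" if "0 \<le> q" for q
          using that const const4 by simp
        from this[OF contraction_nonneg] show ?thesis .
      qed
      have "expectation (\<lambda>\<omega>. norm (y i l \<omega> + mu (Suc i) *\<^sub>R v i l \<omega>) ^ 4)
          \<le> ((contraction i)\<^sup>2 + 8 * t\<^sup>2 * contraction i * \<alpha> + 3 * t ^ 4 * \<alpha>4)
              * expectation (\<lambda>\<omega>. norm (e i l \<omega>) ^ 4)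
            + 8 * t\<^sup>2 * contraction i * s * expectation (\<lambda>\<omega>. (norm (e i l \<omega>))\<^sup>2) + 3 * t ^ 4 * s4"
        unfolding t_def by (rule step(2)[OF int4])
      also have "\<dots> \<le> ((contraction i)\<^sup>2 + 8 * t\<^sup>2 * contraction i * \<alpha> + 3 * t ^ 4 * \<alpha>4) * worst_moment 4 i
            + 8 * t\<^sup>2 * c * s * (2 * E2 / real (Suc i)) + 3 * t ^ 4 * s4"
      proof -
        have mono: "P * X + 8 * t\<^sup>2 * q * s * Y + z \<le> P * X' + 8 * t\<^sup>2 * c * s * Y' + z"
          if "0 \<le> P" "X \<le> X'" "0 \<le> q" "q \<le> c" "0 \<le> Y" "Y \<le> Y'" for P X X' q Y Y' z :: real
        proof -
          have "P * X \<le> P * X'" using that by (intro mult_left_mono)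
          moreover have "8 * t\<^sup>2 * q * s * Y \<le> 8 * t\<^sup>2 * c * s * Y'"
            using that const by (intro mult_mono) auto
          ultimately show ?thesis by simp
        qed
        show ?thesis
          by (rule mono[OF cf expectation_le_worst_moment contraction_nonneg c_le _
                order_trans[OF expectation_le_worst_moment E2_Suc]]) (auto intro!: integral_nonneg_AE)
      qed
      also have "\<dots> \<le> (1 - 4 * lam * t + C * t\<^sup>2) * worst_moment 4 i
            + 8 * t\<^sup>2 * c * s * (2 * E2 / real (Suc i)) + 3 * t ^ 4 * s4"
        using coeff[of i] unfolding t_def by (intro add_right_mono mult_right_mono worst_moment_nonneg)
      finally show "expectation (\<lambda>\<omega>. norm (y i l \<omega> + mu (Suc i) *\<^sub>R v i l \<omega>) ^ 4)
          \<le> (1 - 4 * lam * t + C * t\<^sup>2) * worst_moment 4 i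
            + 8 * t\<^sup>2 * c * s * (2 * E2 / real (Suc i)) + 3 * t ^ 4 * s4" .
    qed simp
    have h1: "8 * t\<^sup>2 * c * s * (2 * E2 / real (Suc i)) = 16 * m\<^sup>2 * c * s * E2 / real (Suc i) ^ Suc 2"
    proof -
      have "8 * (m / n)\<^sup>2 * c * s * (2 * E2 / n) = 16 * m\<^sup>2 * c * s * E2 / n ^ Suc 2" for n :: real
        by (simp add: power_divide power2_eq_square power3_eq_cube eval_nat_numeral mult.assoc)
      then show ?thesis unfolding t_def mu .
    qed
    have h2: "3 * t ^ 4 * s4 \<le> 3 * m ^ 4 * s4 / real (Suc i) ^ Suc 2"
    proof -
      have "3 * t ^ 4 * s4 = 3 * m ^ 4 * s4 / real (Suc i) ^ 4"
        unfolding t_def mu power_divide by simp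
      also have "\<dots> \<le> 3 * m ^ 4 * s4 / real (Suc i) ^ Suc 2"
        using const4 m_pos by (intro divide_left_mono power_increasing mult_pos_pos) auto
      finally show ?thesis .
    qed
    have h3: "1 - 4 * lam * t + C * t\<^sup>2 = 1 - 4 * lam * m / real (Suc i) + C * m\<^sup>2 / real (Suc i) ^ 2"
      unfolding t_def mu power_divide by simp
    show ?case using main h2 unfolding h1 h3 B_def add_divide_distrib by linarith
  qed
  have "\<forall>\<^sub>F i in sequentially. real i ^ 2 * worst_moment 4 i \<le> B / (4 * lam * m - real 2) + 1"
  proof (rule chung_rate[OF rec worst_moment_nonneg])
    show "0 \<le> B" unfolding B_def using const const4 m_pos c_pos E2_nonneg by simp
    show "real 2 < 4 * lam * m" using m by simp
  qed simp
  then show "\<exists>K. \<forall>\<^sub>F i in sequentially. (real i)\<^sup>2 * worst_moment 4 i \<le> K" by blast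
qed

end

section \<open>Convergence of the diffusion strategy\<close>

text \<open>
  A conditional Jensen inequality for the square, from
  \<open>g \<le> g\<^sup>2 / (2 c) + c / 2\<close> with the weight \<open>c\<close> known from the past.
\<close>

lemma (in sigma_finite_subalgebra) nn_cond_exp_le_of_square:
  fixes g c :: "'a \<Rightarrow> real"
  assumes g: "g \<in> borel_measurable M" and c: "c \<in> borel_measurable F" "\<And>x. 0 < c x"
    and bound: "AE x in M. nn_cond_exp M F (\<lambda>x. ennreal ((g x)\<^sup>2)) x \<le> ennreal ((c x)\<^sup>2)"
  shows "AE x in M. nn_cond_exp M F (\<lambda>x. ennreal (g x)) x \<le> ennreal (c x)"
proof -
  have cM: "c \<in> borel_measurable M" by (rule measurable_from_subalg[OF subalg c(1)])
  define h where "h x = ennreal (1 / (2 * c x))" for x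
  define k where "k x = ennreal (c x / 2)" for x
  have meas: "h \<in> borel_measurable F" "k \<in> borel_measurable F"
      "(\<lambda>x. ennreal ((g x)\<^sup>2)) \<in> borel_measurable M" "h \<in> borel_measurable M" "k \<in> borel_measurable M"
    using g c cM unfolding h_def k_def by auto
  have split: "ennreal (g x) \<le> h x * ennreal ((g x)\<^sup>2) + k x" for x
  proof -
    have "0 \<le> (g x - c x)\<^sup>2" by simp
    then have "g x \<le> 1 / (2 * c x) * (g x)\<^sup>2 + c x / 2"
      using c(2)[of x] by (simp add: field_simps power2_eq_square)
    then have "ennreal (g x) \<le> ennreal (1 / (2 * c x) * (g x)\<^sup>2 + c x / 2)" by (rule ennreal_leI)
    also have "\<dots> = h x * ennreal ((g x)\<^sup>2) + k x"
      unfolding h_def k_def using c(2)[of x]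
      by (subst ennreal_plus) (auto simp: less_imp_le simp flip: ennreal_mult)
    finally show ?thesis .
  qed
  have "AE x in M. nn_cond_exp M F (\<lambda>x. ennreal (g x)) x
      \<le> nn_cond_exp M F (\<lambda>x. h x * ennreal ((g x)\<^sup>2) + k x) x"
    by (rule nn_cond_exp_mono) (use g meas split in auto)
  moreover have "AE x in M. nn_cond_exp M F (\<lambda>x. h x * ennreal ((g x)\<^sup>2)) x + nn_cond_exp M F k x
      = nn_cond_exp M F (\<lambda>x. h x * ennreal ((g x)\<^sup>2) + k x) x"
    by (rule nn_cond_exp_sum) (use meas in auto)
  moreover have "AE x in M. h x * nn_cond_exp M F (\<lambda>x. ennreal ((g x)\<^sup>2)) x
      = nn_cond_exp M F (\<lambda>x. h x * ennreal ((g x)\<^sup>2)) x"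
    by (rule nn_cond_exp_prod[OF meas(1,3)])
  moreover have "AE x in M. k x = nn_cond_exp M F k x"
    by (rule nn_cond_exp_F_meas[OF meas(2)])
  ultimately show ?thesis using bound
  proof eventually_elim
    case (elim x)
    have "h x * nn_cond_exp M F (\<lambda>x. ennreal ((g x)\<^sup>2)) x + k x \<le> h x * ennreal ((c x)\<^sup>2) + k x"
      using elim(5) by (intro add_right_mono mult_left_mono) auto
    also have "\<dots> = ennreal (1 / (2 * c x) * (c x)\<^sup>2 + c x / 2)"
      unfolding h_def k_def using c(2)[of x]
      by (subst ennreal_plus) (auto simp: less_imp_le simp flip: ennreal_mult)
    also have "1 / (2 * c x) * (c x)\<^sup>2 + c x / 2 = c x"
      using c(2)[of x] by (simp add: field_simps power2_eq_square)
    finally show ?case using elim(1-4) by simp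
  qed
qed

lemma norm_diff_power_le:
  fixes a b :: "'a::real_normed_vector"
  shows "norm (a - b) ^ r \<le> 2 ^ r * (norm a ^ r + norm b ^ r)"
proof -
  have "norm (a - b) \<le> 2 * max (norm a) (norm b)"
    using norm_triangle_ineq4[of a b] by linarith
  then have "norm (a - b) ^ r \<le> (2 * max (norm a) (norm b)) ^ r"
    by (intro power_mono) auto
  also have "\<dots> = 2 ^ r * max (norm a) (norm b) ^ r" by (rule power_mult_distrib)
  also have "\<dots> \<le> 2 ^ r * (norm a ^ r + norm b ^ r)"
    by (intro mult_left_mono) (auto simp: max_def)
  finally show ?thesis .
qed

lemma (in prob_space) integrable_norm_diff_power:
  fixes f :: "'a \<Rightarrow> 'b::{real_normed_vector, second_countable_topology}"
  assumes "f \<in> borel_measurable M" "integrable M (\<lambda>x. norm (f x) ^ r)"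
  shows "integrable M (\<lambda>x. norm (c - f x) ^ r)"
proof (rule Bochner_Integration.integrable_bound)
  show "integrable M (\<lambda>x. 2 ^ r * (norm c ^ r + norm (f x) ^ r))" using assms by simp
  show "AE x in M. norm (norm (c - f x) ^ r) \<le> norm (2 ^ r * (norm c ^ r + norm (f x) ^ r))"
    using norm_diff_power_le[of c _ r] by (intro AE_I2) (simp add: abs_mult)
qed (use assms(1) in measurable)

lemma limsup_scaled_le:
  fixes E :: "nat \<Rightarrow> real"
  assumes "\<And>i. 0 \<le> E i" "0 \<le> K"
    and le: "\<And>D. K < D \<Longrightarrow> \<forall>\<^sub>F i in sequentially. real i ^ r * E i \<le> D"
  shows "limsup (\<lambda>i. ennreal (E i) / ennreal (inverse (real i ^ r))) \<le> ennreal K"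
proof (rule ennreal_le_epsilon)
  fix \<epsilon> :: real assume "0 < \<epsilon>"
  have "limsup (\<lambda>i. ennreal (E i) / ennreal (inverse (real i ^ r))) \<le> ennreal (K + \<epsilon>)"
  proof (rule Limsup_bounded)
    have "K < K + \<epsilon>" using \<open>0 < \<epsilon>\<close> by simp
    from le[OF this] eventually_gt_at_top[of 0]
    show "\<forall>\<^sub>F i in sequentially. ennreal (E i) / ennreal (inverse (real i ^ r)) \<le> ennreal (K + \<epsilon>)"
    proof eventually_elim
      case (elim i)
      have "ennreal (E i) / ennreal (inverse (real i ^ r)) = ennreal (E i / inverse (real i ^ r))"
        using elim assms by (intro divide_ennreal) auto
      also have "E i / inverse (real i ^ r) = real i ^ r * E i" by (simp add: field_simps)
      finally show ?case using elim by (simp add: ennreal_leI)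
    qed
  qed
  then show "limsup (\<lambda>i. ennreal (E i) / ennreal (inverse (real i ^ r))) \<le> ennreal K + ennreal \<epsilon>"
    using \<open>0 \<le> K\<close> \<open>0 < \<epsilon>\<close> by (simp add: ennreal_plus)
qed

text \<open>
  Take \<open>c = \<surd>\<alpha> \<parallel>wo - w\<parallel>\<^sup>2 + \<sigma>\<^sup>2 + 1\<close> in the previous inequality; its square dominates the
  bound on the fourth moment. The summand \<open>1\<close> keeps \<open>c\<close> positive when \<open>\<alpha>\<close> and \<open>\<sigma>\<close> vanish.
\<close>

lemma second_moment_bound_of_fourth:
  fixes v :: "'n \<Rightarrow> nat \<Rightarrow> real^'m::finite \<Rightarrow> 'w \<Rightarrow> real^'m"
  assumes M: "prob_space M" and sub: "\<And>i. subalgebra M (F i)"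
    and v: "\<And>k i w. 1 \<le> i \<Longrightarrow> w \<in> borel_measurable M \<Longrightarrow> (\<lambda>\<omega>. v k i (w \<omega>) \<omega>) \<in> borel_measurable M"
    and fourth: "fourth_moment_bound M F v wo \<alpha> \<sigma>" and "0 \<le> \<alpha>"
  shows "second_moment_bound M F v wo (sqrt \<alpha>) (sqrt (\<sigma>\<^sup>2 + 1))"
  unfolding second_moment_bound_def
proof (intro allI impI ballI)
  fix k and i :: nat and w :: "'w \<Rightarrow> real^'m" assume "1 \<le> i" and w: "w \<in> borel_measurable (F (i - 1))"
  interpret prob_space M by (rule M)
  interpret G: sigma_finite_subalgebra M "F (i - 1)"
    by (intro finite_measure_subalgebra_is_sigma_finite finite_measure_subalgebra.intro
        finite_measure_subalgebra_axioms.intro sub finite_measure_axioms)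
  have wM: "w \<in> borel_measurable M" by (rule measurable_from_subalg[OF sub w])
  define c where "c \<omega> = sqrt \<alpha> * (norm (wo - w \<omega>))\<^sup>2 + (\<sigma>\<^sup>2 + 1)" for \<omega>
  have "AE \<omega> in M. nn_cond_exp M (F (i - 1)) (\<lambda>\<omega>. ennreal ((norm (v k i (w \<omega>) \<omega>))\<^sup>2)) \<omega> \<le> ennreal (c \<omega>)"
  proof (rule G.nn_cond_exp_le_of_square)
    show "(\<lambda>\<omega>. (norm (v k i (w \<omega>) \<omega>))\<^sup>2) \<in> borel_measurable M"
      using v[OF \<open>1 \<le> i\<close> wM, of k] by measurable
    show "c \<in> borel_measurable (F (i - 1))" unfolding c_def using w by measurable
    show "0 < c \<omega>" for \<omega>
      unfolding c_def using \<open>0 \<le> \<alpha>\<close> by (intro add_nonneg_pos mult_nonneg_nonneg) (auto simp: add_nonneg_pos)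
    have "AE \<omega> in M. nn_cond_exp M (F (i - 1)) (\<lambda>\<omega>. ennreal (norm (v k i (w \<omega>) \<omega>) ^ 4)) \<omega>
        \<le> ennreal (\<alpha> * norm (wo - w \<omega>) ^ 4 + \<sigma> ^ 4)"
      using fourth \<open>1 \<le> i\<close> w unfolding fourth_moment_bound_def by blast
    then show "AE \<omega> in M. nn_cond_exp M (F (i - 1)) (\<lambda>\<omega>. ennreal (((norm (v k i (w \<omega>) \<omega>))\<^sup>2)\<^sup>2)) \<omega>
        \<le> ennreal ((c \<omega>)\<^sup>2)"
    proof eventually_elim
      case (elim \<omega>)
      have "\<alpha> * norm (wo - w \<omega>) ^ 4 + \<sigma> ^ 4 = (sqrt \<alpha> * (norm (wo - w \<omega>))\<^sup>2)\<^sup>2 + (\<sigma>\<^sup>2)\<^sup>2"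
        using \<open>0 \<le> \<alpha>\<close> by (simp add: power_mult_distrib)
      also have "\<dots> \<le> (c \<omega>)\<^sup>2"
      proof -
        have *: "u\<^sup>2 + z\<^sup>2 \<le> (u + (z + 1))\<^sup>2" if "0 \<le> u" "0 \<le> z" for u z :: real
          using that by (simp add: power2_eq_square algebra_simps)
        show ?thesis unfolding c_def by (rule *) (use \<open>0 \<le> \<alpha>\<close> in auto)
      qed
      finally have "ennreal (\<alpha> * norm (wo - w \<omega>) ^ 4 + \<sigma> ^ 4) \<le> ennreal ((c \<omega>)\<^sup>2)"
        by (rule ennreal_leI)
      from order_trans[OF elim this] show ?case by simp
    qed
  qed
  then show "AE \<omega> in M. nn_cond_exp M (F (i - 1)) (\<lambda>\<omega>'. ennreal ((norm (v k i (w \<omega>') \<omega>'))\<^sup>2)) \<omega>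
      \<le> ennreal (sqrt \<alpha> * (norm (wo - w \<omega>))\<^sup>2 + (sqrt (\<sigma>\<^sup>2 + 1))\<^sup>2)"
    by (simp add: c_def add_nonneg_nonneg)
qed

lemma space_history: "space (history M W i) = space M"
  unfolding history_def by (rule space_measure_of) auto

lemma sets_history:
  "sets (history M W i)
    = sigma_sets (space M) {W j k -` B \<inter> space M | j k B. j \<le> i \<and> B \<in> sets borel}"
  unfolding history_def by (rule sets_measure_of) auto

lemma sets_history_mono: "i \<le> j \<Longrightarrow> sets (history M W i) \<subseteq> sets (history M W j)"
  unfolding sets_history by (rule sigma_sets_mono') (auto, metis order_trans)

lemma subalgebra_history:
  assumes "\<And>i k. W i k \<in> borel_measurable M"
  shows "subalgebra M (history M W i)"
  unfolding subalgebra_def space_history sets_history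
  using assms by (auto intro!: sets.sigma_sets_subset simp: measurable_sets)

lemma measurable_history: "W i k \<in> borel_measurable (history M W i)"
  unfolding measurable_def space_history sets_history by auto

text \<open>
  Subtracting the update from \<open>wo = \<Sum>\<^sub>l a\<^sub>l\<^sub>k wo\<close> and splitting each stochastic gradient into
  the gradient of the risk and the noise shows that the errors obey the abstract recursion,
  with Lipschitz constant \<open>2 lam_hi\<close>.
\<close>

lemma diffusion_averaged_recursion:
  fixes M :: "'w measure"
    and Xd :: "'n::finite \<Rightarrow> 'x measure"
    and x :: "'n \<Rightarrow> nat \<Rightarrow> 'w \<Rightarrow> 'x"
    and Q :: "real^'m::finite \<Rightarrow> 'x \<Rightarrow> real"
    and J :: "'n \<Rightarrow> real^'m \<Rightarrow> real"
    and A :: "real^'n^'n"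
  assumes setting: "diffusion_setting M Xd x Q J conn A w0"
    and W_eq: "W = diffusion A Q x mu w0"
    and F_eq: "F = history M W"
    and v_eq: "v = grad_noise Q J x"
    and risk: "risk_assumption J lam_lo lam_hi wo"
    and noise: "noise_assumption M F v wo"
    and mu_pos: "\<And>i. i \<ge> 1 \<Longrightarrow> mu i > 0"
  shows "\<And>i. subalgebra M (F i)"
    and "\<And>k i w. 1 \<le> i \<Longrightarrow> w \<in> borel_measurable M \<Longrightarrow> (\<lambda>\<omega>. v k i (w \<omega>) \<omega>) \<in> borel_measurable M"
    and "\<And>\<alpha> \<sigma>. 0 \<le> \<alpha> \<Longrightarrow> second_moment_bound M F v wo \<alpha> \<sigma> \<Longrightarrow>
      averaged_recursion M F A mu (\<lambda>i k \<omega>. wo - W i k \<omega>)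
        (\<lambda>i k \<omega>. wo - W i k \<omega> + mu (Suc i) *\<^sub>R gradient (J k) (W i k \<omega>))
        (\<lambda>i k \<omega>. v k (Suc i) (W i k \<omega>) \<omega>) lam_lo (2 * lam_hi) \<alpha> (\<sigma>\<^sup>2)"
proof -
  interpret prob_space M using setting by (simp add: diffusion_setting_def)
  have x: "x k i \<in> measurable M (Xd k)" if "1 \<le> i" for k i
    using setting that by (simp add: diffusion_setting_def)
  have Q: "Q w \<in> borel_measurable (Xd k)" for k w
    using setting by (simp add: diffusion_setting_def)
  have Q_diff: "(\<lambda>u. Q u z) differentiable (at w)" if "z \<in> space (Xd k)" for k z w
    using setting that by (simp add: diffusion_setting_def)
  have A: "0 \<le> A $ l $ k" "(\<Sum>l\<in>UNIV. A $ l $ k) = 1" for l k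
    using setting by (auto simp: diffusion_setting_def)
  have w0: "w0 k \<in> borel_measurable M" "integrable M (\<lambda>\<omega>. (norm (w0 k \<omega>))\<^sup>2)" for k
    using setting by (auto simp: diffusion_setting_def)
  have J: "twice_cont_diff (J k)" for k using risk by (simp add: risk_assumption_def)
  have grad_J: "gradient (J k) \<in> borel_measurable borel" for k
  proof (rule borel_measurable_continuous_onI)
    show "continuous_on UNIV (gradient (J k))"
      using J[of k] by (intro differentiable_imp_continuous_on)
        (simp add: twice_cont_diff_def differentiable_on_def)
  qed
  have grad_Q: "(\<lambda>\<omega>. gradient (\<lambda>u. Q u (x k i \<omega>)) (w \<omega>)) \<in> borel_measurable M"
    if "1 \<le> i" "w \<in> borel_measurable M" for k i w
    by (rule measurable_gradient_caratheodory[OF Q Q_diff that(2) x[OF that(1)]])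
  show v: "(\<lambda>\<omega>. v k i (w \<omega>) \<omega>) \<in> borel_measurable M"
    if "1 \<le> i" "w \<in> borel_measurable M" for k i w
    unfolding v_eq grad_noise_def
    by (intro borel_measurable_diff grad_Q that measurable_compose[OF that(2) grad_J])
  have W: "W i k \<in> borel_measurable M" for i k
  proof (induction i arbitrary: k)
    case 0
    show ?case using w0 by (simp add: W_eq)
  next
    case (Suc i)
    have "(\<lambda>\<omega>. \<Sum>l\<in>UNIV. A $ l $ k *\<^sub>R (W i l \<omega> - mu (Suc i) *\<^sub>R gradient (\<lambda>u. Q u (x l (Suc i) \<omega>)) (W i l \<omega>)))
        \<in> borel_measurable M"
      by (intro borel_measurable_sum borel_measurable_scaleR borel_measurable_diff
          borel_measurable_const Suc.IH grad_Q) auto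
    then show ?case by (simp add: W_eq combine_def[abs_def] adapt_def)
  qed
  show sub: "subalgebra M (F i)" for i unfolding F_eq by (rule subalgebra_history[OF W])
  have WF: "W i k \<in> borel_measurable (F i)" for i k unfolding F_eq by (rule measurable_history)
  have lam: "0 < lam_lo" "lam_lo \<le> lam_hi" using risk by (auto simp: risk_assumption_def)
  have grad_bounds: "lam_lo * (norm (w - wo))\<^sup>2 \<le> (w - wo) \<bullet> gradient (J k) w"
      "norm (gradient (J k) w) \<le> 2 * lam_hi * norm (w - wo)" for k w
  proof -
    have "loewner_le (mat lam_lo) (hessian (J k) u)" "loewner_le (hessian (J k) u) (mat lam_hi)"
      "is_arg_min (J k) (\<lambda>_. True) wo" for u
      using risk by (auto simp: risk_assumption_def)
    note gradient_strongly_monotone_lipschitz[OF J this(1,2) less_imp_le[OF lam(1)] this(3)]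
    then show "lam_lo * (norm (w - wo))\<^sup>2 \<le> (w - wo) \<bullet> gradient (J k) w"
      "norm (gradient (J k) w) \<le> 2 * lam_hi * norm (w - wo)" by blast+
  qed
  fix \<alpha> \<sigma> assume "0 \<le> \<alpha>" and second: "second_moment_bound M F v wo \<alpha> \<sigma>"
  show "averaged_recursion M F A mu (\<lambda>i k \<omega>. wo - W i k \<omega>)
        (\<lambda>i k \<omega>. wo - W i k \<omega> + mu (Suc i) *\<^sub>R gradient (J k) (W i k \<omega>))
        (\<lambda>i k \<omega>. v k (Suc i) (W i k \<omega>) \<omega>) lam_lo (2 * lam_hi) \<alpha> (\<sigma>\<^sup>2)"
  proof
    show "subalgebra M (F i)" for i by (rule sub)
    show "sets (F i) \<subseteq> sets (F j)" if "i \<le> j" for i j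
      unfolding F_eq using that by (rule sets_history_mono)
    show "(\<lambda>\<omega>. wo - W i k \<omega>) \<in> borel_measurable (F i)" for i k
      by (intro borel_measurable_diff borel_measurable_const WF)
    show "(\<lambda>\<omega>. wo - W i k \<omega> + mu (Suc i) *\<^sub>R gradient (J k) (W i k \<omega>)) \<in> borel_measurable (F i)" for i k
      by (intro borel_measurable_add borel_measurable_diff borel_measurable_const
          borel_measurable_scaleR WF measurable_compose[OF WF grad_J])
    show "(\<lambda>\<omega>. v k (Suc i) (W i k \<omega>) \<omega>) \<in> borel_measurable M" for i k
      by (rule v[OF _ W]) simp
    show "0 \<le> A $ l $ k" "(\<Sum>l\<in>UNIV. A $ l $ k) = 1" for l k by (fact A)+
    show "wo - W (Suc i) k \<omega> = (\<Sum>l\<in>UNIV. A $ l $ k *\<^sub>R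
        (wo - W i l \<omega> + mu (Suc i) *\<^sub>R gradient (J l) (W i l \<omega>) + mu (Suc i) *\<^sub>R v l (Suc i) (W i l \<omega>) \<omega>))"
      for i k \<omega>
    proof -
      let ?g = "\<lambda>l. gradient (\<lambda>u. Q u (x l (Suc i) \<omega>)) (W i l \<omega>)"
      have "wo = (\<Sum>l\<in>UNIV. A $ l $ k *\<^sub>R wo)" using A(2)[of k] by (simp flip: scaleR_sum_left)
      moreover have "W (Suc i) k \<omega> = (\<Sum>l\<in>UNIV. A $ l $ k *\<^sub>R (W i l \<omega> - mu (Suc i) *\<^sub>R ?g l))"
        by (simp add: W_eq combine_def adapt_def)
      ultimately have "wo - W (Suc i) k \<omega>
          = (\<Sum>l\<in>UNIV. A $ l $ k *\<^sub>R wo) - (\<Sum>l\<in>UNIV. A $ l $ k *\<^sub>R (W i l \<omega> - mu (Suc i) *\<^sub>R ?g l))"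
        by simp
      also have "\<dots> = (\<Sum>l\<in>UNIV. A $ l $ k *\<^sub>R (wo - (W i l \<omega> - mu (Suc i) *\<^sub>R ?g l)))"
        by (simp only: sum_subtractf scaleR_right_diff_distrib)
      finally show ?thesis by (simp add: v_eq grad_noise_def algebra_simps)
    qed
    show "(norm (wo - W i k \<omega> + mu (Suc i) *\<^sub>R gradient (J k) (W i k \<omega>)))\<^sup>2
        \<le> (1 - 2 * lam_lo * mu (Suc i) + (2 * lam_hi)\<^sup>2 * (mu (Suc i))\<^sup>2) * (norm (wo - W i k \<omega>))\<^sup>2" for i k \<omega>
      using mu_pos[of "Suc i"] by (intro gradient_step_contracts grad_bounds) auto
    show "AE \<omega> in M. vec_cond_exp M (F i) (\<lambda>\<omega>. v k (Suc i) (W i k \<omega>) \<omega>) \<omega> = 0" for i k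
    proof -
      have "W i k \<in> borel_measurable (F (Suc i - 1))" using WF by simp
      then have "AE \<omega> in M. vec_cond_exp M (F (Suc i - 1)) (\<lambda>\<omega>. v k (Suc i) (W i k \<omega>) \<omega>) \<omega> = 0"
        by (intro noise[unfolded noise_assumption_def, THEN conjunct1, rule_format]) simp_all
      then show ?thesis by simp
    qed
    show "AE \<omega> in M. nn_cond_exp M (F i) (\<lambda>\<omega>. ennreal ((norm (v k (Suc i) (W i k \<omega>) \<omega>))\<^sup>2)) \<omega>
        \<le> ennreal (\<alpha> * (norm (wo - W i k \<omega>))\<^sup>2 + \<sigma>\<^sup>2)" for i k
    proof -
      have "W i k \<in> borel_measurable (F (Suc i - 1))" using WF by simp
      then have "AE \<omega> in M. nn_cond_exp M (F (Suc i - 1)) (\<lambda>\<omega>. ennreal ((norm (v k (Suc i) (W i k \<omega>) \<omega>))\<^sup>2)) \<omega>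
          \<le> ennreal (\<alpha> * (norm (wo - W i k \<omega>))\<^sup>2 + \<sigma>\<^sup>2)"
        by (intro second[unfolded second_moment_bound_def, rule_format]) simp_all
      then show ?thesis by simp
    qed
    show "integrable M (\<lambda>\<omega>. (norm (wo - W 0 k \<omega>))\<^sup>2)" for k
      using w0[of k] by (simp add: W_eq integrable_norm_diff_power)
  qed (use \<open>0 \<le> \<alpha>\<close> lam mu_pos in auto)
qed

theorem theorem1:
  fixes M :: "'w measure"
    and Xd :: "'n::finite \<Rightarrow> 'x measure"
    and x :: "'n \<Rightarrow> nat \<Rightarrow> 'w \<Rightarrow> 'x"
    and Q :: "real^'m::finite \<Rightarrow> 'x \<Rightarrow> real"
    and J :: "'n \<Rightarrow> real^'m \<Rightarrow> real"
    and conn :: "'n \<Rightarrow> 'n \<Rightarrow> bool"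
    and A :: "real^'n^'n"
    and p :: "real^'n"
    and w0 :: "'n \<Rightarrow> 'w \<Rightarrow> real^'m"
    and wo :: "real^'m"
    and lam_lo lam_hi :: real
    and mu :: "nat \<Rightarrow> real"
    and W :: "nat \<Rightarrow> 'n \<Rightarrow> 'w \<Rightarrow> real^'m"
    and F :: "nat \<Rightarrow> 'w measure"
    and v :: "'n \<Rightarrow> nat \<Rightarrow> real^'m \<Rightarrow> 'w \<Rightarrow> real^'m"
  assumes setting: "diffusion_setting M Xd x Q J conn A w0"
    and W_eq: "W = diffusion A Q x mu w0"
    and F_eq: "F = history M W"
    and v_eq: "v = grad_noise Q J x"
    and risk: "risk_assumption J lam_lo lam_hi wo"
    and noise: "noise_assumption M F v wo"
    and topology: "topology_assumption conn A p"
    and mu_pos: "\<And>i. i \<ge> 1 \<Longrightarrow> mu i > 0"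
    and mu_sum: "filterlim (\<lambda>n. \<Sum>i=1..n. mu i) at_top sequentially"
    and mu_lim: "mu \<longlonglongrightarrow> 0"
  shows
    "(\<forall>k. (\<lambda>i. \<integral>\<^sup>+\<omega>. ennreal (norm (wo - W i k \<omega>) ^ 2) \<partial>M) \<longlonglongrightarrow> 0) \<and>
     (summable (\<lambda>i. mu i ^ 2) \<longrightarrow>
        (\<forall>k. AE \<omega> in M. (\<lambda>i. W i k \<omega>) \<longlonglongrightarrow> wo)) \<and>
     (\<exists>\<alpha>2\<ge>0. \<exists>\<sigma>v2. second_moment_bound M F v wo \<alpha>2 \<sigma>v2) \<and>
     (\<forall>m. (\<forall>i\<ge>1. mu i = m / real i) \<and> 2 * lam_lo * m > 1 \<longrightarrow>
        (\<forall>\<alpha>2\<ge>0. \<forall>\<sigma>v2. second_moment_bound M F v wo \<alpha>2 \<sigma>v2 \<longrightarrow>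
           (\<forall>k. limsup (\<lambda>i. (\<integral>\<^sup>+\<omega>. ennreal (norm (wo - W i k \<omega>) ^ 2) \<partial>M)
                               / ennreal (inverse (real i)))
                  \<le> ennreal (\<sigma>v2 ^ 2 * m ^ 2 / (2 * lam_lo * m - 1)))) \<and>
        ((\<forall>k. integrable M (\<lambda>\<omega>. norm (w0 k \<omega>) ^ 4)) \<longrightarrow>
           (\<forall>k. \<exists>C::real. limsup (\<lambda>i. (\<integral>\<^sup>+\<omega>. ennreal (norm (wo - W i k \<omega>) ^ 4) \<partial>M)
                               / ennreal (inverse (real i ^ 2)))
                  \<le> ennreal C)))"
proof -
  note recursion = diffusion_averaged_recursion[OF setting W_eq F_eq v_eq risk noise mu_pos]
  have M: "prob_space M" using setting by (simp add: diffusion_setting_def)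
  obtain \<alpha>4 \<sigma>4 where "0 \<le> \<alpha>4" and fourth: "fourth_moment_bound M F v wo \<alpha>4 \<sigma>4"
    using noise[unfolded noise_assumption_def, THEN conjunct2, THEN conjunct1] by blast
  have second: "second_moment_bound M F v wo (sqrt \<alpha>4) (sqrt (\<sigma>4\<^sup>2 + 1))"
    by (rule second_moment_bound_of_fourth[OF M recursion(1,2) fourth \<open>0 \<le> \<alpha>4\<close>])
  have sqrt_nonneg: "0 \<le> sqrt \<alpha>4" using \<open>0 \<le> \<alpha>4\<close> by simp
  have sum_Suc: "filterlim (\<lambda>n. \<Sum>i<n. mu (Suc i)) at_top sequentially"
    using mu_sum by (simp add: sum.atLeast1_atMost_eq)
  \<comment> \<open>one pair of constants, for the claims in which their values do not matter;
      the sharp rate uses the recursion again with the constants given there\<close>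
  interpret R: averaged_recursion M F A mu "\<lambda>i k \<omega>. wo - W i k \<omega>"
    "\<lambda>i k \<omega>. wo - W i k \<omega> + mu (Suc i) *\<^sub>R gradient (J k) (W i k \<omega>)"
    "\<lambda>i k \<omega>. v k (Suc i) (W i k \<omega>) \<omega>" lam_lo "2 * lam_hi" "sqrt \<alpha>4" "(sqrt (\<sigma>4\<^sup>2 + 1))\<^sup>2"
    by (rule recursion(3)[OF _ sqrt_nonneg second])
  have nn_moment: "(\<integral>\<^sup>+\<omega>. ennreal (norm (wo - W i k \<omega>) ^ r) \<partial>M)
      = ennreal (R.expectation (\<lambda>\<omega>. norm (wo - W i k \<omega>) ^ r))"
    if "integrable M (\<lambda>\<omega>. norm (wo - W i k \<omega>) ^ r)" for i k r
    using that by (intro nn_integral_eq_integral) auto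
  note nn_square = nn_moment[OF R.e_square_integrable]
  have moment_nonneg: "0 \<le> R.expectation (\<lambda>\<omega>. norm (wo - W i k \<omega>) ^ r)" for i k r
    by (intro integral_nonneg_AE) auto
  show ?thesis
  proof (intro conjI allI impI; (elim conjE)?)
    fix k
    have "(\<lambda>i. R.expectation (\<lambda>\<omega>. (norm (wo - W i k \<omega>))\<^sup>2)) \<longlonglongrightarrow> 0"
      by (rule tendsto_sandwich[OF always_eventually always_eventually tendsto_const
            R.worst_second_moment_tendsto_0[OF sum_Suc mu_lim]])
        (intro allI moment_nonneg R.expectation_le_worst_moment)+
    then show "(\<lambda>i. \<integral>\<^sup>+\<omega>. ennreal ((norm (wo - W i k \<omega>))\<^sup>2) \<partial>M) \<longlonglongrightarrow> 0"
      unfolding nn_square by (intro tendsto_ennrealI[where x = 0, simplified])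
  next
    fix k assume "summable (\<lambda>i. (mu i)\<^sup>2)"
    then have "AE \<omega> in M. \<forall>k. (\<lambda>i. wo - W i k \<omega>) \<longlonglongrightarrow> 0"
      using topology sum_Suc mu_lim
      by (intro R.AE_tendsto_0[of p]) (auto simp: topology_assumption_def)
    then show "AE \<omega> in M. (\<lambda>i. W i k \<omega>) \<longlonglongrightarrow> wo"
    proof eventually_elim
      case (elim \<omega>)
      have "(\<lambda>i. wo - (wo - W i k \<omega>)) \<longlonglongrightarrow> wo - 0"
        by (intro tendsto_diff tendsto_const elim[rule_format])
      then show ?case by simp
    qed
  next
    show "\<exists>\<alpha>2\<ge>0. \<exists>\<sigma>v2. second_moment_bound M F v wo \<alpha>2 \<sigma>v2"
      using second sqrt_nonneg by blast
  next
    fix m \<alpha>2 \<sigma>v2 k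
    assume mu: "\<forall>i\<ge>1. mu i = m / real i" and m: "2 * lam_lo * m > 1"
      and "0 \<le> \<alpha>2" and bound: "second_moment_bound M F v wo \<alpha>2 \<sigma>v2"
    interpret S: averaged_recursion M F A mu "\<lambda>i k \<omega>. wo - W i k \<omega>"
      "\<lambda>i k \<omega>. wo - W i k \<omega> + mu (Suc i) *\<^sub>R gradient (J k) (W i k \<omega>)"
      "\<lambda>i k \<omega>. v k (Suc i) (W i k \<omega>) \<omega>" lam_lo "2 * lam_hi" \<alpha>2 "\<sigma>v2\<^sup>2"
      by (rule recursion(3)[OF _ \<open>0 \<le> \<alpha>2\<close> bound])
    have "limsup (\<lambda>i. ennreal (R.expectation (\<lambda>\<omega>. (norm (wo - W i k \<omega>))\<^sup>2)) / ennreal (inverse (real i ^ 1)))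
        \<le> ennreal (\<sigma>v2\<^sup>2 * m\<^sup>2 / (2 * lam_lo * m - 1))"
    proof (rule limsup_scaled_le[OF moment_nonneg])
      show "0 \<le> \<sigma>v2\<^sup>2 * m\<^sup>2 / (2 * lam_lo * m - 1)" using m by simp
      fix D assume "\<sigma>v2\<^sup>2 * m\<^sup>2 / (2 * lam_lo * m - 1) < D"
      then have "\<forall>\<^sub>F i in sequentially. real i * S.worst_moment 2 i \<le> D"
        using mu m by (intro S.worst_second_moment_rate[where m = m]) auto
      then show "\<forall>\<^sub>F i in sequentially. real i ^ 1 * R.expectation (\<lambda>\<omega>. (norm (wo - W i k \<omega>))\<^sup>2) \<le> D"
        by eventually_elim
          (simp add: order_trans[OF mult_left_mono[OF S.expectation_le_worst_moment]])
    qed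
    then show "limsup (\<lambda>i. (\<integral>\<^sup>+\<omega>. ennreal ((norm (wo - W i k \<omega>))\<^sup>2) \<partial>M) / ennreal (inverse (real i)))
        \<le> ennreal (\<sigma>v2\<^sup>2 * m\<^sup>2 / (2 * lam_lo * m - 1))"
      unfolding nn_square by simp
  next
    fix m k
    assume mu: "\<forall>i\<ge>1. mu i = m / real i" and m: "2 * lam_lo * m > 1"
      and init4: "\<forall>k. integrable M (\<lambda>\<omega>. norm (w0 k \<omega>) ^ 4)"
    have fourth': "AE \<omega> in M. nn_cond_exp M (F i) (\<lambda>\<omega>. ennreal (norm (v k (Suc i) (W i k \<omega>) \<omega>) ^ 4)) \<omega>
        \<le> ennreal (\<alpha>4 * norm (wo - W i k \<omega>) ^ 4 + \<sigma>4 ^ 4)" for i k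
    proof -
      have "W i k \<in> borel_measurable (F (Suc i - 1))" unfolding F_eq by (simp add: measurable_history)
      then have "AE \<omega> in M. nn_cond_exp M (F (Suc i - 1)) (\<lambda>\<omega>. ennreal (norm (v k (Suc i) (W i k \<omega>) \<omega>) ^ 4)) \<omega>
          \<le> ennreal (\<alpha>4 * norm (wo - W i k \<omega>) ^ 4 + \<sigma>4 ^ 4)"
        by (intro fourth[unfolded fourth_moment_bound_def, rule_format]) simp_all
      then show ?thesis by simp
    qed
    have w0: "w0 k \<in> borel_measurable M" for k
      using setting by (simp add: diffusion_setting_def)
    have init: "integrable M (\<lambda>\<omega>. norm (wo - W 0 k \<omega>) ^ 4)" for k
      using R.integrable_norm_diff_power[OF w0 init4[rule_format]] by (simp add: W_eq)
    have mu': "mu (Suc i) = m / real (Suc i)" for i using mu by simp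
    note rate = R.fourth_moment_rate[OF fourth' \<open>0 \<le> \<alpha>4\<close> zero_le_even_power init mu' m, simplified]
    obtain K where K: "\<forall>\<^sub>F i in sequentially. (real i)\<^sup>2 * R.worst_moment 4 i \<le> K"
      using rate(2) by blast
    \<comment> \<open>the maximum, since \<open>ennreal\<close> maps negative numbers to \<open>0\<close>\<close>
    have "limsup (\<lambda>i. ennreal (R.expectation (\<lambda>\<omega>. norm (wo - W i k \<omega>) ^ 4)) / ennreal (inverse (real i ^ 2)))
        \<le> ennreal (max 0 K)"
    proof (rule limsup_scaled_le[OF moment_nonneg])
      fix D assume D: "max 0 K < D"
      from K show "\<forall>\<^sub>F i in sequentially. real i ^ 2 * R.expectation (\<lambda>\<omega>. norm (wo - W i k \<omega>) ^ 4) \<le> D"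
      proof eventually_elim
        case (elim i)
        have "real i ^ 2 * R.expectation (\<lambda>\<omega>. norm (wo - W i k \<omega>) ^ 4) \<le> real i ^ 2 * R.worst_moment 4 i"
          by (intro mult_left_mono R.expectation_le_worst_moment) simp
        then show ?case using elim D by simp
      qed
    qed simp
    then show "\<exists>C. limsup (\<lambda>i. (\<integral>\<^sup>+\<omega>. ennreal (norm (wo - W i k \<omega>) ^ 4) \<partial>M) / ennreal (inverse ((real i)\<^sup>2)))
        \<le> ennreal C"
      unfolding nn_moment[OF rate(1)] by blast
  qed
qed

end
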